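(* Let $K>0$, $\gamma\ge 1$, $\xi\ne 0$, $\lambda\in\mathbb{R}$, $\alpha\ge 0$, $a_0>0$, $a_1\in\mathbb{R}$, $b_0>0$, $b_1\in\mathbb{R}$ be constants. Let $(a(t),b(t))$, with $a,b>0$, be the solution of the Emden system $$\ddot a(t)-\frac{\xi^2}{a^3(t)}=\frac{\lambda}{a^{2\gamma-1}(t)\,b^{\gamma-1}(t)},\quad a(0)=a_0,\ \dot a(0)=a_1,$$ $$\ddot b(t)=\frac{\lambda}{a^{2\gamma-2}(t)\,b^{\gamma}(t)},\quad b(0)=b_0,\ \dot b(0)=b_1,$$ and consider the associated solution $$\rho=\frac{f(s)}{a^2(t)b(t)},\qquad u_1=\frac{\dot a(t)}{a(t)}x-\frac{\xi}{a^2(t)}y,\qquad u_2=\frac{\xi}{a^2(t)}x+\frac{\dot a(t)}{a(t)}y,\qquad u_3=\frac{\dot b(t)}{b(t)}z$$ of the compressible Euler equations $\rho_t+\nabla\cdot(\rho\vec u)=0$, $\rho[\vec u_t+(\vec u\cdot\nabla)\vec u]+K\nabla\rho^\gamma=0$ in $\mathbb{R}^3$, where $s=\frac{x^2+y^2}{a^2(t)}+\frac{z^2}{b^2(t)}$, $f(s)=\alpha e^{-\frac{\lambda}{2K}s}$ if $\gamma=1$, and $f(s)=\max\left(\left(-\frac{\lambda(\gamma-1)}{2K\gamma}s+\alpha\right)^{\frac1{\gamma-1}},0\right)$ if $\gamma>1$. Then: (1) if $\lambda>0$, the solution is global; (2) if $\lambda=0$ and (2a) $b_1\ge 0$, the solution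 is global; (2b) $b_1<0$, the solution blows up in a finite time $T$; (3) if $\lambda<0$ and (3a) $\gamma=1$, the solution blows up in a finite time $T$; (3b) $\gamma>1$ and $b_1\le 0$, the solution blows up in a finite time $T$.
   Context: Dots denote derivatives with respect to $t$. For $\gamma>1$, $f(s)$ is taken to be $0$ wherever the base $-\frac{\lambda(\gamma-1)}{2K\gamma}s+\alpha$ is negative. The solution $(\rho,\vec u)$ is defined as long as the solution $(a,b)$ of the Emden system exists with $a,b>0$. "Global" means that the maximal forward interval of existence of $(a,b)$ with $a,b>0$ is $[0,\infty)$; "blows up in a finite time $T$" means that this maximal interval is $[0,T)$ with $T<\infty$. *)

theory Defs
  imports "HOL-Analysis.Analysis"
begin

definition forward_interval :: "ereal \<Rightarrow> real set" where
  "forward_interval T = {t. 0 \<le> t \<and> ereal t < T}"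

text \<open>The functions \<open>a'\<close> and \<open>b'\<close> are the time derivatives of \<open>a\<close> and \<open>b\<close>; at \<open>t = 0\<close> all
  time derivatives are one-sided. Values outside \<open>[0,T)\<close> play no role.\<close>

definition emden_solution ::
  "real \<Rightarrow> real \<Rightarrow> real \<Rightarrow> real \<Rightarrow> real \<Rightarrow> real \<Rightarrow> real \<Rightarrow> ereal
    \<Rightarrow> (real \<Rightarrow> real) \<Rightarrow> (real \<Rightarrow> real) \<Rightarrow> (real \<Rightarrow> real) \<Rightarrow> (real \<Rightarrow> real) \<Rightarrow> bool" where
  "emden_solution \<gamma> \<xi> \<Lambda> a0 a1 b0 b1 T a a' b b' \<longleftrightarrow>
     0 < T \<and> a 0 = a0 \<and> a' 0 = a1 \<and> b 0 = b0 \<and> b' 0 = b1 \<and>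
     (\<forall>t\<in>forward_interval T.
        a t > 0 \<and> b t > 0 \<and>
        (a has_real_derivative a' t) (at t within forward_interval T) \<and>
        (b has_real_derivative b' t) (at t within forward_interval T) \<and>
        (\<exists>a'' b''.
           (a' has_real_derivative a'') (at t within forward_interval T) \<and>
           (b' has_real_derivative b'') (at t within forward_interval T) \<and>
           a'' - \<xi>\<^sup>2 / a t ^ 3 = \<Lambda> / (a t powr (2 * \<gamma> - 1) * b t powr (\<gamma> - 1)) \<and>
           b'' = \<Lambda> / (a t powr (2 * \<gamma> - 2) * b t powr \<gamma>)))"

definition maximal_emden_solution ::
  "real \<Rightarrow> real \<Rightarrow> real \<Rightarrow> real \<Rightarrow> real \<Rightarrow> real \<Rightarrow> real \<Rightarrow> ereal
    \<Rightarrow> (real \<Rightarrow> real) \<Rightarrow> (real \<Rightarrow> real) \<Rightarrow> (real \<Rightarrow> real) \<Rightarrow> (real \<Rightarrow> real) \<Rightarrow> bool" where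
  "maximal_emden_solution \<gamma> \<xi> \<Lambda> a0 a1 b0 b1 T a a' b b' \<longleftrightarrow>
     emden_solution \<gamma> \<xi> \<Lambda> a0 a1 b0 b1 T a a' b b' \<and>
     \<not> (\<exists>S A A' B B'. T < S \<and> emden_solution \<gamma> \<xi> \<Lambda> a0 a1 b0 b1 S A A' B B' \<and>
          (\<forall>t\<in>forward_interval T. A t = a t \<and> B t = b t))"

definition profile :: "real \<Rightarrow> real \<Rightarrow> real \<Rightarrow> real \<Rightarrow> real \<Rightarrow> real" where
  "profile K \<gamma> \<Lambda> \<alpha> s =
     (if \<gamma> = 1 then \<alpha> * exp (- \<Lambda> / (2 * K) * s)
      else let w = - (\<Lambda> * (\<gamma> - 1) / (2 * K * \<gamma>)) * s + \<alpha>
           in if w < 0 then 0 else max (w powr (1 / (\<gamma> - 1))) 0)"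

definition gas_density ::
  "real \<Rightarrow> real \<Rightarrow> real \<Rightarrow> real \<Rightarrow> (real \<Rightarrow> real) \<Rightarrow> (real \<Rightarrow> real)
    \<Rightarrow> real \<Rightarrow> real^3 \<Rightarrow> real" where
  "gas_density K \<gamma> \<Lambda> \<alpha> a b t p =
     profile K \<gamma> \<Lambda> \<alpha> (((p$1)\<^sup>2 + (p$2)\<^sup>2) / (a t)\<^sup>2 + (p$3)\<^sup>2 / (b t)\<^sup>2) / ((a t)\<^sup>2 * b t)"

definition velocity ::
  "real \<Rightarrow> (real \<Rightarrow> real) \<Rightarrow> (real \<Rightarrow> real) \<Rightarrow> (real \<Rightarrow> real) \<Rightarrow> (real \<Rightarrow> real)
    \<Rightarrow> real \<Rightarrow> real^3 \<Rightarrow> real^3" where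
  "velocity \<xi> a a' b b' t p =
     vector [a' t / a t * p$1 - \<xi> / (a t)\<^sup>2 * p$2,
             \<xi> / (a t)\<^sup>2 * p$1 + a' t / a t * p$2,
             b' t / b t * p$3]"

definition has_divergence :: "(real^'n \<Rightarrow> real^'n) \<Rightarrow> real \<Rightarrow> real^'n \<Rightarrow> bool" where
  "has_divergence F d p \<longleftrightarrow>
     (\<exists>F'. (F has_derivative F') (at p) \<and> d = (\<Sum>i\<in>UNIV. F' (axis i 1) $ i))"

definition vacuum_boundary :: "(real \<Rightarrow> real^3 \<Rightarrow> real) \<Rightarrow> real \<Rightarrow> (real^3) set" where
  "vacuum_boundary \<rho> t = frontier {p. \<rho> t p > 0}"

text \<open>Compressible Euler equations with pressure \<open>K \<rho>\<^sup>\<gamma>\<close>, in the classical pointwise sense on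
  \<open>[0,T) \<times> \<real>\<^sup>3\<close>. For \<open>\<gamma> \<ge> 2\<close> a density behaving like \<open>w powr (1 / (\<gamma> - 1))\<close> near the
  vacuum is in general not differentiable on the vacuum boundary, so for such \<open>\<gamma>\<close> the continuity
  equation is required off that boundary only. The momentum equation is required everywhere;
  \<open>Du (u t p)\<close> is the convective term \<open>(u \<bullet> \<nabla>) u\<close>.\<close>

definition euler_solution ::
  "real \<Rightarrow> real \<Rightarrow> ereal \<Rightarrow> (real \<Rightarrow> real^3 \<Rightarrow> real) \<Rightarrow> (real \<Rightarrow> real^3 \<Rightarrow> real^3) \<Rightarrow> bool" where
  "euler_solution K \<gamma> T \<rho> u \<longleftrightarrow>
     (\<forall>t\<in>forward_interval T. \<forall>p.
        (\<gamma> < 2 \<or> p \<notin> vacuum_boundary \<rho> t \<longrightarrow>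
           (\<exists>\<rho>\<^sub>t d. ((\<lambda>\<tau>. \<rho> \<tau> p) has_real_derivative \<rho>\<^sub>t) (at t within forward_interval T) \<and>
              has_divergence (\<lambda>q. \<rho> t q *\<^sub>R u t q) d p \<and>
              \<rho>\<^sub>t + d = 0)) \<and>
        (\<exists>u\<^sub>t Du G. ((\<lambda>\<tau>. u \<tau> p) has_vector_derivative u\<^sub>t) (at t within forward_interval T) \<and>
              (u t has_derivative Du) (at p) \<and>
              GDERIV (\<lambda>q. \<rho> t q powr \<gamma>) p :> G \<and>
              \<rho> t p *\<^sub>R (u\<^sub>t + Du (u t p)) + K *\<^sub>R G = 0))"

end

theory Submission
  imports Defs
begin

text \<open>
  The flow conserves \<open>E = a'\<^sup>2 + b'\<^sup>2/2 + \<xi>\<^sup>2/a\<^sup>2 + \<Lambda> \<Phi>(a\<^sup>2b)\<close>, where \<open>\<Phi>\<close> is the internal energy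
  of the gas as a function of the volume, and \<open>\<Phi>(V) \<ge> - ln V\<close> for every \<open>\<gamma> \<ge> 1\<close>. For \<open>\<Lambda> \<ge> 0\<close> this
  bounds \<open>|a' + b'|\<close> by a multiple of \<open>sqrt (1 + a + b)\<close>, so \<open>a\<close>, \<open>b\<close> and their derivatives stay
  bounded on bounded intervals; then \<open>\<xi>\<^sup>2/a\<^sup>2\<close> keeps \<open>a\<close> away from \<open>0\<close>, and for \<open>\<Lambda> > 0\<close>
  the inequality \<open>0 \<le> E + \<Lambda> ln (a\<^sup>2b)\<close> does the same for \<open>b\<close>. A solution that stays in a compact
  part of the phase space has a limit at a finite end point and is continued beyond it by
  Picard--Lindeloef.

  For \<open>\<Lambda> \<le> 0\<close> blow-up is due to \<open>b\<close> alone: as soon as \<open>b'\<close> is bounded above by a negative constant,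
  \<open>b\<close> reaches \<open>0\<close> in finite time. In the isothermal attractive case \<open>b'\<^sup>2/2 - \<Lambda> ln b\<close> is conserved,
  hence \<open>b\<close> is bounded and \<open>b'' = \<Lambda>/b\<close> is bounded above by a negative constant.

  In the Euler equations the only delicate points are the zeros of the base \<open>w\<close> of the profile. The
  pressure involves \<open>w\<^sub>+\<close> to the power \<open>\<gamma>/(\<gamma> - 1) > 1\<close> and is continuously differentiable there; the
  density need not be when \<open>\<gamma> \<ge> 2\<close>, but a zero of \<open>w\<close> off the vacuum boundary forces \<open>\<alpha> = 0\<close> and
  \<open>\<Lambda> \<ge> 0\<close>, so that the density vanishes identically.
\<close>

section \<open>Continuation of solutions of autonomous systems\<close>

text \<open>Banach's fixed point theorem for the integral operator \<open>P\<close> on bounded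
  continuous functions with values in the ball. These functions live on the whole line, so the upper
  limit of the integral is clamped to \<open>[0,h]\<close>.\<close>

lemma picard_local_existence:
  fixes f :: "'a::euclidean_space \<Rightarrow> 'a"
  assumes r: "0 < r" and L: "L-lipschitz_on (cball p r) f"
  obtains h x where "0 < h" "x 0 = p" "\<And>t. x t \<in> cball p r"
    "\<And>t. t \<in> {0..h} \<Longrightarrow> (x has_vector_derivative f (x t)) (at t within {0..h})"
proof -
  have L0: "0 \<le> L" using lipschitz_on_nonneg[OF L] .
  define M where "M = norm (f p) + L * r"
  have M0: "0 \<le> M" using L0 r by (simp add: M_def)
  have fM: "norm (f v) \<le> M" if "v \<in> cball p r" for v
  proof -
    have "norm (f v - f p) \<le> L * dist v p"
      using lipschitz_onD[OF L that, of p] r by (simp add: dist_norm)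
    also have "\<dots> \<le> L * r" using that L0 by (intro mult_left_mono) (auto simp: dist_commute)
    finally show ?thesis unfolding M_def using norm_triangle_sub[of "f v" "f p"] by linarith
  qed
  \<comment> \<open>The first bound keeps the integral within distance \<open>r\<close> of the
    centre, the second makes \<open>P\<close> a contraction with constant 1/2. Adding 1 keeps both
    denominators positive.\<close>
  define h where "h = min (r / (M + 1)) (1 / (2 * (L + 1)))"
  have h0: "0 < h" using r M0 L0 by (simp add: h_def)
  have "M * h \<le> (M + 1) * (r / (M + 1))"
    using M0 h0 r by (intro mult_mono) (auto simp: h_def)
  then have hM: "M * h \<le> r" using M0 by simp
  have "L * h \<le> (L + 1) * (1 / (2 * (L + 1)))"
    using L0 h0 by (intro mult_mono) (auto simp: h_def)
  also have "\<dots> = 1 / 2" using L0 by (simp add: divide_simps)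
  finally have hL: "L * h \<le> 1 / 2" .
  define c where "c t = max 0 (min t h)" for t :: real
  have c: "c t \<in> {0..h}" for t using h0 by (auto simp: c_def)
  have contc: "continuous_on UNIV c" unfolding c_def by (intro continuous_intros)
  define S :: "(real \<Rightarrow>\<^sub>C 'a) set" where "S = PiC UNIV (\<lambda>_. cball p r)"
  define P where "P x t = p + integral {0..c t} (\<lambda>s. f (apply_bcontfun x s))"
    for x :: "real \<Rightarrow>\<^sub>C 'a" and t
  have inS: "apply_bcontfun x s \<in> cball p r" if "x \<in> S" for x s
    using that by (auto simp: S_def mem_PiC_iff)
  have cf: "continuous_on A (\<lambda>s. f (apply_bcontfun x s))" if "x \<in> S" for x A
    by (rule continuous_on_compose2[OF lipschitz_on_continuous_on[OF L]])
       (use inS[OF that] in auto)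
  have Pball: "P x t \<in> cball p r" if "x \<in> S" for x t
  proof -
    have "norm (integral {0..c t} (\<lambda>s. f (apply_bcontfun x s))) \<le> M * (c t - 0)"
      using c[of t] by (intro integral_bound cf that fM inS) auto
    also have "\<dots> \<le> M * h" using c[of t] M0 by (intro mult_left_mono) auto
    finally show ?thesis using hM by (simp add: P_def dist_norm)
  qed
  have contP: "continuous_on UNIV (P x)" if "x \<in> S" for x
  proof -
    have "continuous_on {0..h} (\<lambda>t. integral {0..t} (\<lambda>s. f (apply_bcontfun x s)))"
      by (intro indefinite_integral_continuous_1 integrable_continuous_real cf that)
    then have "continuous_on UNIV (\<lambda>t. integral {0..c t} (\<lambda>s. f (apply_bcontfun x s)))"
      by (rule continuous_on_compose2[OF _ contc]) (use c in auto)
    then show ?thesis unfolding P_def by (intro continuous_intros)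
  qed
  have Pb: "P x \<in> bcontfun" if "x \<in> S" for x
  proof -
    have "bounded (range (P x))"
      by (rule bounded_subset[OF bounded_cball[of p r]]) (use Pball[OF that] in auto)
    then show ?thesis using contP[OF that] by (simp add: bcontfun_def)
  qed
  have app: "apply_bcontfun (Bcontfun (P x)) = P x" if "x \<in> S" for x
    using Pb[OF that] by (rule Bcontfun_inverse)
  have "\<exists>!x\<in>S. Bcontfun (P x) = x"
  proof (rule Banach_fix[where c = "1/2"])
    show "complete S"
      unfolding S_def complete_eq_closed by (rule closed_PiC) auto
    have "const_bcontfun p \<in> S"
      using r by (auto simp: S_def mem_PiC_iff const_bcontfun.rep_eq)
    then show "S \<noteq> {}" by auto
    show "(\<lambda>x. Bcontfun (P x)) ` S \<subseteq> S"
      using Pball by (auto simp: S_def mem_PiC_iff app[unfolded S_def])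
    fix x y assume xy: "x \<in> S" "y \<in> S"
    show "dist (Bcontfun (P x)) (Bcontfun (P y)) \<le> 1/2 * dist x y"
    proof (rule dist_bound)
      fix t
      have i: "(\<lambda>s. f (apply_bcontfun z s)) integrable_on {0..c t}" if "z \<in> S" for z
        by (intro integrable_continuous_real cf that)
      have "dist (P x t) (P y t)
          = norm (integral {0..c t} (\<lambda>s. f (apply_bcontfun x s) - f (apply_bcontfun y s)))"
        by (simp add: P_def dist_norm integral_diff i xy)
      also have "\<dots> \<le> (L * dist x y) * (c t - 0)"
      proof (intro integral_bound continuous_intros cf xy)
        fix s
        have "norm (f (apply_bcontfun x s) - f (apply_bcontfun y s))
            \<le> L * dist (apply_bcontfun x s) (apply_bcontfun y s)"
          using lipschitz_onD[OF L inS[OF xy(1)] inS[OF xy(2)]] by (simp add: dist_norm)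
        also have "\<dots> \<le> L * dist x y" using L0 by (intro mult_left_mono dist_bounded)
        finally show "norm (f (apply_bcontfun x s) - f (apply_bcontfun y s)) \<le> L * dist x y" .
      qed (use c[of t] in auto)
      also have "\<dots> \<le> (L * dist x y) * h" using c[of t] L0 by (intro mult_left_mono) auto
      also have "\<dots> = (L * h) * dist x y" by simp
      also have "\<dots> \<le> 1/2 * dist x y" by (rule mult_right_mono[OF hL]) simp
      finally show "dist (apply_bcontfun (Bcontfun (P x)) t) (apply_bcontfun (Bcontfun (P y)) t)
          \<le> 1/2 * dist x y"
        by (simp add: app xy)
    qed
  qed auto
  then obtain x where x: "x \<in> S" "Bcontfun (P x) = x" by auto
  have fp: "apply_bcontfun x t = p + integral {0..t} (\<lambda>s. f (apply_bcontfun x s))"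
    if "t \<in> {0..h}" for t
  proof -
    have "c t = t" using that by (auto simp: c_def)
    then show ?thesis using app[OF x(1)] x(2) P_def[of x t] by simp
  qed
  show ?thesis
  proof (rule that[OF h0, of "apply_bcontfun x"])
    show "apply_bcontfun x 0 = p" using h0 fp[of 0] by simp
    show "apply_bcontfun x t \<in> cball p r" for t using inS[OF x(1)] .
    fix t assume t: "t \<in> {0..h}"
    have "((\<lambda>u. p + integral {0..u} (\<lambda>s. f (apply_bcontfun x s)))
        has_vector_derivative f (apply_bcontfun x t)) (at t within {0..h})"
      using integral_has_vector_derivative[OF cf[OF x(1)] t]
      by (auto intro!: derivative_eq_intros)
    then show "(apply_bcontfun x has_vector_derivative f (apply_bcontfun x t)) (at t within {0..h})"
      by (rule has_vector_derivative_transform[OF t, rotated])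
         (rule fp)
  qed
qed

text \<open>Since \<open>f\<close> is bounded on \<open>K\<close>, the curve \<open>x\<close> is
  Lipschitz and extends continuously to \<open>T\<close>. The limit stays in the closed set
  \<open>K\<close>, hence in \<open>U\<close>, and a Picard solution started there is glued
  on.\<close>

lemma ode_continuation:
  fixes f :: "'a::euclidean_space \<Rightarrow> 'a" and x :: "real \<Rightarrow> 'a"
  assumes T: "0 < T"
    and U: "open U"
    and lip: "\<And>p. p \<in> U \<Longrightarrow> \<exists>r>0. \<exists>L. cball p r \<subseteq> U \<and> L-lipschitz_on (cball p r) f"
    and K: "compact K" "K \<subseteq> U"
    and xK: "\<And>t. t \<in> {0..<T} \<Longrightarrow> x t \<in> K"
    and x': "\<And>t. t \<in> {0..<T} \<Longrightarrow> (x has_vector_derivative f (x t)) (at t within {0..<T})"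
  obtains h y where "0 < h" "\<And>t. t \<in> {0..<T} \<Longrightarrow> y t = x t"
    "\<And>t. t \<in> {0..T + h} \<Longrightarrow> y t \<in> U"
    "\<And>t. t \<in> {0..T + h} \<Longrightarrow> (y has_vector_derivative f (y t)) (at t within {0..T + h})"
proof -
  have contf: "continuous_on U f"
  proof (rule continuous_at_imp_continuous_on, rule ballI)
    fix p assume "p \<in> U"
    then obtain r L where r: "0 < r" "L-lipschitz_on (cball p r) f" using lip by blast
    have "continuous_on (ball p r) f"
      using continuous_on_subset[OF lipschitz_on_continuous_on[OF r(2)] ball_subset_cball] .
    then show "isCont f p" using r(1) by (simp add: continuous_on_eq_continuous_at)
  qed
  have "bounded (f ` K)"
    by (intro compact_imp_bounded compact_continuous_image continuous_on_subset[OF contf] K)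
  then obtain M where M: "0 < M" "\<And>v. v \<in> K \<Longrightarrow> norm (f v) \<le> M"
    by (auto simp: bounded_pos)
  have "M-lipschitz_on {0..<T} x"
  proof (rule lipschitz_onI)
    fix s t assume st: "s \<in> {0..<T}" "t \<in> {0..<T}"
    have "norm (x s - x t) \<le> M * norm (s - t)"
    proof (rule differentiable_bound[where S = "{0..<T}" and f' = "\<lambda>t h. h *\<^sub>R f (x t)"])
      fix t assume t: "t \<in> {0..<T}"
      show "(x has_derivative (\<lambda>h. h *\<^sub>R f (x t))) (at t within {0..<T})"
        using x'[OF t] by (simp add: has_vector_derivative_def)
      show "onorm (\<lambda>h. h *\<^sub>R f (x t)) \<le> M"
        using M(2)[OF xK[OF t]] by (intro onorm_bound)
             (use M in \<open>auto simp: mult.commute[of M] intro!: mult_left_mono\<close>)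
    qed (use st in auto)
    then show "dist (x s) (x t) \<le> M * dist s t" by (simp add: dist_norm)
  qed (use M in simp)
  then obtain g where g: "M-lipschitz_on (closure {0..<T}) g" "\<And>t. t \<in> {0..<T} \<Longrightarrow> g t = x t"
    using lipschitz_extend_closure by blast
  have cl: "closure {0..<T} = {0..T}" using T by simp
  have contg: "continuous_on {0..T} g"
    using lipschitz_on_continuous_on[OF g(1)] cl by simp
  have "g ` closure {0..<T} \<subseteq> K"
    by (rule image_closure_subset) (use contg cl g(2) xK compact_imp_closed[OF K(1)] in auto)
  then have gK: "g t \<in> K" if "t \<in> {0..T}" for t using that cl by auto
  have gT: "g T \<in> U" using gK[of T] K T by auto
  then obtain r L where r: "0 < r" "cball (g T) r \<subseteq> U" "L-lipschitz_on (cball (g T) r) f"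
    using lip by blast
  obtain h z where z: "0 < h" "z 0 = g T" "\<And>t. z t \<in> cball (g T) r"
    "\<And>t. t \<in> {0..h} \<Longrightarrow> (z has_vector_derivative f (z t)) (at t within {0..h})"
    using picard_local_existence[OF r(1,3)] by blast
  define y where "y t = (if t \<le> T then g t else z (t - T))" for t
  have contz: "continuous_on {0..h} z"
    unfolding continuous_on_eq_continuous_within using z(4) has_vector_derivative_continuous by blast
  have conty: "continuous_on {0..T + h} y"
  proof -
    have "continuous_on ({0..T} \<union> {T..T + h}) (\<lambda>t. if t \<le> T then g t else z (t - T))"
    proof (rule continuous_on_cases)
      show "continuous_on {T..T + h} (\<lambda>t. z (t - T))"
        by (rule continuous_on_compose2[OF contz]) (auto intro!: continuous_intros)
    qed (use contg z(2) in auto)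
    moreover have "{0..T} \<union> {T..T + h} = {0..T + h}" using T z(1) by auto
    ultimately show ?thesis unfolding y_def by simp
  qed
  have yU: "y t \<in> U" if "t \<in> {0..T + h}" for t
    using that gK[of t] K z(3) r(2) by (auto simp: y_def)
  have dery: "(y has_vector_derivative f (y t)) (at t)" if t: "t \<in> {0<..<T + h} - {T}" for t
  proof (cases "t < T")
    case True
    have "(x has_vector_derivative f (x t)) (at t within {0<..<T})"
      using x'[of t] True t by (auto intro: has_vector_derivative_within_subset)
    then have "(x has_vector_derivative f (x t)) (at t)"
      using True t at_within_open[of t "{0<..<T}"] by simp
    moreover have "y t = x t" using True t g(2) by (simp add: y_def)
    ultimately have "(x has_vector_derivative f (y t)) (at t)" by simp
    then show ?thesis
      by (rule has_vector_derivative_transform_within_open[where S = "{0<..<T}"])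
         (use t True in \<open>auto simp: y_def g(2)\<close>)
  next
    case False
    have "(z has_vector_derivative f (z (t - T))) (at (t - T) within {0<..<h})"
      using z(4)[of "t - T"] False t by (auto intro: has_vector_derivative_within_subset)
    then have "(z has_vector_derivative f (z (t - T))) (at (t - T))"
      using False t at_within_open[of "t - T" "{0<..<h}"] by simp
    then have "((z \<circ> (\<lambda>t. t - T)) has_vector_derivative 1 *\<^sub>R f (z (t - T))) (at t)"
      by (intro vector_diff_chain_at) (auto intro!: derivative_eq_intros)
    then have "((\<lambda>t. z (t - T)) has_vector_derivative f (y t)) (at t)"
      using False t by (simp add: o_def y_def)
    then show ?thesis
      by (rule has_vector_derivative_transform_within_open[where S = "{T<..}"])
         (use False t in \<open>auto simp: y_def\<close>)
  qed
  have contfy: "continuous_on {0..T + h} (\<lambda>s. f (y s))"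
    by (rule continuous_on_compose2[OF contf conty]) (use yU in auto)
  \<comment> \<open>So far the derivative is known only at interior times other than
    \<open>T\<close>. The fundamental theorem of calculus tolerates the exceptional point, and the
    resulting integral equation, with its continuous integrand, yields the derivative at
    \<open>T\<close> and at the end points too.\<close>
  have eq: "y t = y 0 + integral {0..t} (\<lambda>s. f (y s))" if t: "t \<in> {0..T + h}" for t
  proof -
    have "((\<lambda>s. f (y s)) has_integral (y t - y 0)) {0..t}"
      by (rule fundamental_theorem_of_calculus_interior_strong[of "{T}"])
         (use t in \<open>auto intro!: dery continuous_on_subset[OF conty]\<close>)
    then show ?thesis by (simp add: integral_unique)
  qed
  show ?thesis
  proof (rule that[of h y])
    show "0 < h" by (rule z)
    show "y t = x t" if "t \<in> {0..<T}" for t using that g(2) by (simp add: y_def)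
    show "y t \<in> U" if "t \<in> {0..T + h}" for t by (rule yU[OF that])
    fix t assume t: "t \<in> {0..T + h}"
    have "((\<lambda>t. y 0 + integral {0..t} (\<lambda>s. f (y s))) has_vector_derivative f (y t))
        (at t within {0..T + h})"
      using integral_has_vector_derivative[OF contfy t] by (auto intro!: derivative_eq_intros)
    then show "(y has_vector_derivative f (y t)) (at t within {0..T + h})"
      by (rule has_vector_derivative_transform[OF t, rotated]) (rule eq)
  qed
qed

section \<open>Estimates from derivatives\<close>

text \<open>Compactness bounds the gradient, and the mean value inequality on the convex set turns
  that bound into a Lipschitz constant.\<close>

lemma lipschitz_on_gradient:
  fixes f :: "'a::real_inner \<Rightarrow> real"
  assumes C: "compact C" "convex C"
    and f: "\<And>v. v \<in> C \<Longrightarrow> (f has_derivative (\<lambda>h. G v \<bullet> h)) (at v)"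
    and G: "continuous_on C G"
  obtains L where "L-lipschitz_on C f"
proof -
  have "bounded (G ` C)" by (intro compact_imp_bounded compact_continuous_image G C)
  then obtain B where B: "0 < B" "\<And>v. v \<in> C \<Longrightarrow> norm (G v) \<le> B" by (auto simp: bounded_pos)
  have "B-lipschitz_on C f"
  proof (rule lipschitz_onI)
    fix u v assume uv: "u \<in> C" "v \<in> C"
    have "norm (f u - f v) \<le> B * norm (u - v)"
    proof (rule differentiable_bound[OF C(2)])
      fix w assume w: "w \<in> C"
      show "(f has_derivative (\<lambda>h. G w \<bullet> h)) (at w within C)"
        using f[OF w] by (rule has_derivative_at_withinI)
      show "onorm (\<lambda>h. G w \<bullet> h) \<le> B"
      proof (rule onorm_bound)
        fix h
        have "norm (G w \<bullet> h) \<le> norm (G w) * norm h" by (simp add: Cauchy_Schwarz_ineq2)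
        also have "\<dots> \<le> B * norm h" using B(2)[OF w] by (rule mult_right_mono) simp
        finally show "norm (G w \<bullet> h) \<le> B * norm h" .
      qed (use B in simp)
    qed (use uv in auto)
    then show "dist (f u) (f v) \<le> B * dist u v" by (simp add: dist_norm)
  qed (use B in simp)
  then show ?thesis by (rule that)
qed

text \<open>The mean value theorem, with derivatives relative to a larger set \<open>J\<close> so
  that the one-sided derivatives in \<open>emden_solution\<close> can be inserted unchanged.\<close>

lemma derivative_le_imp_linear_bound:
  fixes f :: "real \<Rightarrow> real"
  assumes "s \<le> t" "{s..t} \<subseteq> J"
    and f: "\<And>x. x \<in> {s..t} \<Longrightarrow> (f has_real_derivative f' x) (at x within J)"
    and c: "\<And>x. x \<in> {s..t} \<Longrightarrow> f' x \<le> c"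
  shows "f t \<le> f s + c * (t - s)"
proof (cases "s = t")
  case False
  then have "s < t" using assms(1) by simp
  moreover have "(f has_derivative (*) (f' x)) (at x within {s..t})" if "s \<le> x" "x \<le> t" for x
    using f[of x] assms(2) that
    by (auto intro: has_derivative_subset simp: has_field_derivative_def)
  ultimately obtain x where x: "x \<in> {s<..<t}" "f t - f s = f' x * (t - s)"
    using mvt_simple[of s t f "\<lambda>x. (*) (f' x)"] by auto
  then have "f t - f s \<le> c * (t - s)" using c[of x] by (auto intro!: mult_right_mono)
  then show ?thesis by simp
qed simp

lemma derivative_neg_imp_less:
  fixes f :: "real \<Rightarrow> real"
  assumes "s < t" "{s..t} \<subseteq> J"
    and f: "\<And>x. x \<in> {s..t} \<Longrightarrow> (f has_real_derivative f' x) (at x within J)"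
    and c: "\<And>x. x \<in> {s..t} \<Longrightarrow> f' x < 0"
  shows "f t < f s"
proof -
  have "(f has_derivative (*) (f' x)) (at x within {s..t})" if "s \<le> x" "x \<le> t" for x
    using f[of x] assms(2) that
    by (auto intro: has_derivative_subset simp: has_field_derivative_def)
  then obtain x where x: "x \<in> {s<..<t}" "f t - f s = f' x * (t - s)"
    using mvt_simple[OF \<open>s < t\<close>, of f "\<lambda>x. (*) (f' x)"] by auto
  then have "f' x * (t - s) < 0" using c[of x] by (auto intro!: mult_neg_pos)
  then show ?thesis using x by simp
qed

text \<open>The differential inequality says that \<open>sqrt G\<close> has slope at most
  \<open>c\<close>. So \<open>sqrt G\<close> grows at most linearly, and \<open>G\<close> stays
  bounded on a bounded interval.\<close>

lemma sqrt_growth_bound: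
  fixes G G' :: "real \<Rightarrow> real"
  assumes t: "t \<in> {0..<\<tau>}" and c: "0 \<le> c"
    and G: "\<And>t. t \<in> {0..<\<tau>} \<Longrightarrow> (G has_real_derivative G' t) (at t within {0..<\<tau>})"
    and pos: "\<And>t. t \<in> {0..<\<tau>} \<Longrightarrow> 0 < G t"
    and G': "\<And>t. t \<in> {0..<\<tau>} \<Longrightarrow> G' t \<le> 2 * c * sqrt (G t)"
  shows "G t \<le> (sqrt (G 0) + c * \<tau>)\<^sup>2"
proof -
  have "sqrt (G t) \<le> sqrt (G 0) + c * (t - 0)"
  proof (rule derivative_le_imp_linear_bound[where J = "{0..<\<tau>}"])
    fix s assume "s \<in> {0..t}"
    then have s: "s \<in> {0..<\<tau>}" using t by auto
    show "((\<lambda>t. sqrt (G t)) has_real_derivative G' s / (2 * sqrt (G s))) (at s within {0..<\<tau>})"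
      using G[OF s] pos[OF s] by (auto intro!: derivative_eq_intros simp: field_simps)
    show "G' s / (2 * sqrt (G s)) \<le> c"
      using G'[OF s] pos[OF s] by (simp add: field_simps)
  qed (use t in auto)
  also have "\<dots> \<le> sqrt (G 0) + c * \<tau>" using t c by (auto intro!: mult_left_mono)
  finally have "(sqrt (G t))\<^sup>2 \<le> (sqrt (G 0) + c * \<tau>)\<^sup>2"
    using pos[OF t] by (intro power_mono) auto
  then show ?thesis using pos[OF t] by simp
qed

section \<open>The Emden system\<close>

lemma forward_interval_ereal [simp]: "forward_interval (ereal \<tau>) = {0..<\<tau>}"
  by (auto simp: forward_interval_def)

lemma forward_interval_infinity [simp]: "forward_interval \<infinity> = {0..}"
  by (auto simp: forward_interval_def)

lemma convex_forward_interval: "convex (forward_interval T)"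
proof -
  have "is_interval (forward_interval T)"
    unfolding is_interval_1 forward_interval_def
    by (auto intro: le_less_trans[of "ereal _" "ereal _"])
  then show ?thesis by (simp add: is_interval_convex_1)
qed

section \<open>The system as a locally Lipschitz vector field, and continuation of its
  solutions\<close>

definition radial_force :: "real \<Rightarrow> real \<Rightarrow> real \<Rightarrow> real \<Rightarrow> real \<Rightarrow> real" where
  "radial_force \<gamma> \<xi> \<Lambda> x y = \<xi>\<^sup>2 / x ^ 3 + \<Lambda> / (x powr (2 * \<gamma> - 1) * y powr (\<gamma> - 1))"

definition axial_force :: "real \<Rightarrow> real \<Rightarrow> real \<Rightarrow> real \<Rightarrow> real" where
  "axial_force \<gamma> \<Lambda> x y = \<Lambda> / (x powr (2 * \<gamma> - 2) * y powr \<gamma>)"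

lemma emden_solutionD:
  assumes "emden_solution \<gamma> \<xi> \<Lambda> a0 a1 b0 b1 T a a' b b'"
  shows "0 < T" "a 0 = a0" "a' 0 = a1" "b 0 = b0" "b' 0 = b1"
    and "t \<in> forward_interval T \<Longrightarrow> 0 < a t"
    and "t \<in> forward_interval T \<Longrightarrow> 0 < b t"
    and "t \<in> forward_interval T \<Longrightarrow> (a has_real_derivative a' t) (at t within forward_interval T)"
    and "t \<in> forward_interval T \<Longrightarrow> (b has_real_derivative b' t) (at t within forward_interval T)"
    and "t \<in> forward_interval T \<Longrightarrow>
      (a' has_real_derivative radial_force \<gamma> \<xi> \<Lambda> (a t) (b t)) (at t within forward_interval T)"
    and "t \<in> forward_interval T \<Longrightarrow>
      (b' has_real_derivative axial_force \<gamma> \<Lambda> (a t) (b t)) (at t within forward_interval T)"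
  using assms by (auto simp: emden_solution_def radial_force_def axial_force_def algebra_simps)

text \<open>Phase space is grouped as \<open>((a, b), (a', b'))\<close>, positions first, so that
  both forces are functions of \<open>fst z\<close>.\<close>

definition emden_field ::
  "real \<Rightarrow> real \<Rightarrow> real \<Rightarrow> (real \<times> real) \<times> (real \<times> real) \<Rightarrow> (real \<times> real) \<times> (real \<times> real)" where
  "emden_field \<gamma> \<xi> \<Lambda> z = (snd z,
     (radial_force \<gamma> \<xi> \<Lambda> (fst (fst z)) (snd (fst z)), axial_force \<gamma> \<Lambda> (fst (fst z)) (snd (fst z))))"

text \<open>At positive positions every term of the forces is a multiple of such a product, possibly
  with negative exponents. Its gradient is continuous as long as both coordinates are
  positive.\<close>

lemma lipschitz_on_powr_mult_powr:
  fixes C :: "(real \<times> real) set"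
  assumes C: "compact C" "convex C" and pos: "C \<subseteq> {0<..} \<times> {0<..}"
  obtains L where "L-lipschitz_on C (\<lambda>v. fst v powr r * snd v powr s)"
proof (rule lipschitz_on_gradient[OF C])
  fix v assume "v \<in> C"
  then have v: "0 < fst v" "0 < snd v" using pos by auto
  show "((\<lambda>v. fst v powr r * snd v powr s) has_derivative
     (\<lambda>h. (r * fst v powr (r - 1) * snd v powr s, s * fst v powr r * snd v powr (s - 1)) \<bullet> h)) (at v)"
    using v by (auto intro!: derivative_eq_intros simp: fun_eq_iff inner_prod_def powr_diff field_simps)
next
  show "continuous_on C (\<lambda>v. (r * fst v powr (r - 1) * snd v powr s,
      s * fst v powr r * snd v powr (s - 1)))"
    using pos by (intro continuous_intros) auto
qed

text \<open>The velocities enter linearly, and the forces depend on the positions alone, which range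
  over the compact convex projection of a small ball.\<close>

lemma emden_field_locally_lipschitz:
  assumes p: "p \<in> ({0<..} \<times> {0<..}) \<times> UNIV"
  shows "\<exists>r>0. \<exists>L. cball p r \<subseteq> ({0<..} \<times> {0<..}) \<times> UNIV \<and>
    L-lipschitz_on (cball p r) (emden_field \<gamma> \<xi> \<Lambda>)"
proof -
  let ?U = "({0<..} \<times> {0<..}) \<times> UNIV :: ((real \<times> real) \<times> (real \<times> real)) set"
  have "open ?U" by (intro open_Times) auto
  then obtain r where r: "0 < r" "cball p r \<subseteq> ?U"
    using p open_contains_cball by blast
  have bl: "1-lipschitz_on A (fst :: (real \<times> real) \<times> (real \<times> real) \<Rightarrow> real \<times> real)"
    "1-lipschitz_on A (snd :: (real \<times> real) \<times> (real \<times> real) \<Rightarrow> real \<times> real)" for A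
    by (intro lipschitz_onI; simp add: dist_fst_le dist_snd_le)+
  let ?C = "fst ` cball p r"
  have C: "compact ?C" "convex ?C"
    by (auto intro!: compact_continuous_image continuous_intros convex_linear_image linear_fst)
  have pos: "?C \<subseteq> {0<..} \<times> {0<..}" using r(2) by auto
  have powr_lip: "\<exists>L. L-lipschitz_on (cball p r) (\<lambda>z. fst (fst z) powr e * snd (fst z) powr e')" for e e'
  proof -
    obtain L where "L-lipschitz_on ?C (\<lambda>v. fst v powr e * snd v powr e')"
      using lipschitz_on_powr_mult_powr[OF C pos] by blast
    then show ?thesis using lipschitz_on_compose2[OF bl(1)[of "cball p r"]] by blast
  qed
  \<comment> \<open>\<open>F\<close> is the field with its quotients rewritten as products of
    powers. The factor with exponent 0 equals 1 on the ball and only serves to match the shape of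
    \<open>powr_lip\<close>.\<close>
  define F where "F z = (snd z,
    (\<xi>\<^sup>2 * (fst (fst z) powr (-3) * snd (fst z) powr 0)
      + \<Lambda> * (fst (fst z) powr (1 - 2 * \<gamma>) * snd (fst z) powr (1 - \<gamma>)),
     \<Lambda> * (fst (fst z) powr (2 - 2 * \<gamma>) * snd (fst z) powr (- \<gamma>))))"
    for z :: "(real \<times> real) \<times> (real \<times> real)"
  obtain L1 L2 L3 where
    "L1-lipschitz_on (cball p r) (\<lambda>z. fst (fst z) powr (-3) * snd (fst z) powr 0)"
    "L2-lipschitz_on (cball p r) (\<lambda>z. fst (fst z) powr (1 - 2 * \<gamma>) * snd (fst z) powr (1 - \<gamma>))"
    "L3-lipschitz_on (cball p r) (\<lambda>z. fst (fst z) powr (2 - 2 * \<gamma>) * snd (fst z) powr (- \<gamma>))"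
    using powr_lip[of "-3" 0] powr_lip[of "1 - 2 * \<gamma>" "1 - \<gamma>"] powr_lip[of "2 - 2 * \<gamma>" "- \<gamma>"]
    by (elim exE)
  note lips = this
  have "\<exists>L. L-lipschitz_on (cball p r) F"
    unfolding F_def
    by (rule exI, rule lipschitz_on_Pair, rule bl(2), rule lipschitz_on_Pair, rule lipschitz_on_add)
       (rule lipschitz_on_cmult_real, rule lips)+
  then obtain L where L: "L-lipschitz_on (cball p r) F" ..
  have eq: "emden_field \<gamma> \<xi> \<Lambda> z = F z" if "z \<in> cball p r" for z
  proof -
    have pos: "0 < fst (fst z)" "0 < snd (fst z)" using that r(2) by auto
    have "fst (fst z) powr (-3) = inverse (fst (fst z) ^ 3)"
      using pos by (simp add: powr_minus)
    moreover have "x powr (1 - 2 * \<gamma>) = inverse (x powr (2 * \<gamma> - 1))"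
      "x powr (2 - 2 * \<gamma>) = inverse (x powr (2 * \<gamma> - 2))"
      "x powr (1 - \<gamma>) = inverse (x powr (\<gamma> - 1))" "x powr (- \<gamma>) = inverse (x powr \<gamma>)" for x :: real
      using powr_minus[of x "2 * \<gamma> - 1"] powr_minus[of x "2 * \<gamma> - 2"] powr_minus[of x "\<gamma> - 1"]
      by (simp_all add: powr_minus)
    ultimately show ?thesis
      using pos unfolding emden_field_def F_def radial_force_def axial_force_def
      by (simp add: divide_inverse)
  qed
  have "L-lipschitz_on (cball p r) (emden_field \<gamma> \<xi> \<Lambda>)"
    using L eq by (auto intro: lipschitz_on_transform)
  then show ?thesis using r by blast
qed

text \<open>Such bounds confine the trajectory to a compact box inside the domain of the field, and
  continuing it beyond \<open>\<tau>\<close> contradicts maximality.\<close>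

lemma maximal_emden_solution_unbounded:
  assumes max: "maximal_emden_solution \<gamma> \<xi> \<Lambda> a0 a1 b0 b1 (ereal \<tau>) a a' b b'"
    and l: "0 < l"
    and bd: "\<And>t. t \<in> {0..<\<tau>} \<Longrightarrow> l \<le> a t \<and> l \<le> b t \<and> a t \<le> u \<and> b t \<le> u \<and> \<bar>a' t\<bar> \<le> u \<and> \<bar>b' t\<bar> \<le> u"
  shows False
proof -
  let ?U = "({0<..} \<times> {0<..}) \<times> UNIV :: ((real \<times> real) \<times> (real \<times> real)) set"
  let ?K = "({l..u} \<times> {l..u}) \<times> ({-u..u} \<times> {-u..u})"
  let ?F = "emden_field \<gamma> \<xi> \<Lambda>"
  have sol: "emden_solution \<gamma> \<xi> \<Lambda> a0 a1 b0 b1 (ereal \<tau>) a a' b b'"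
    using max by (simp add: maximal_emden_solution_def)
  note D = emden_solutionD[OF sol, simplified]
  define x where "x t = ((a t, b t), (a' t, b' t))" for t
  have x': "(x has_vector_derivative ?F (x t)) (at t within {0..<\<tau>})" if "t \<in> {0..<\<tau>}" for t
    unfolding x_def emden_field_def using that D(8-11)[of t]
    by (auto intro!: has_vector_derivative_Pair simp: has_real_derivative_iff_has_vector_derivative)
  have U: "open ?U" by (intro open_Times) auto
  have K: "compact ?K" "?K \<subseteq> ?U" using l by (auto intro!: compact_Times)
  have xK: "x t \<in> ?K" if "t \<in> {0..<\<tau>}" for t using bd[OF that] by (auto simp: x_def abs_le_iff)
  obtain h y where y: "0 < h" "\<And>t. t \<in> {0..<\<tau>} \<Longrightarrow> y t = x t"
    "\<And>t. t \<in> {0..\<tau> + h} \<Longrightarrow> y t \<in> ?U"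
    "\<And>t. t \<in> {0..\<tau> + h} \<Longrightarrow> (y has_vector_derivative ?F (y t)) (at t within {0..\<tau> + h})"
    using ode_continuation[OF D(1) U emden_field_locally_lipschitz K xK x'] by blast
  define A where "A t = fst (fst (y t))" for t
  define B where "B t = snd (fst (y t))" for t
  define A' where "A' t = fst (snd (y t))" for t
  define B' where "B' t = snd (snd (y t))" for t
  \<comment> \<open>The continued curve lives on a closed interval; dropping the right end point
    gives the half-open interval that \<open>emden_solution\<close> demands.\<close>
  let ?J = "{0..<\<tau> + h}"
  have y': "(y has_vector_derivative ?F (y t)) (at t within ?J)" if "t \<in> ?J" for t
    using y(4)[of t] that by (auto intro: has_vector_derivative_within_subset)
  have ders: "(A has_real_derivative A' t) (at t within ?J)"
    "(B has_real_derivative B' t) (at t within ?J)"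
    "(A' has_real_derivative radial_force \<gamma> \<xi> \<Lambda> (A t) (B t)) (at t within ?J)"
    "(B' has_real_derivative axial_force \<gamma> \<Lambda> (A t) (B t)) (at t within ?J)" if t: "t \<in> ?J" for t
  proof -
    note fst' = bounded_linear.has_vector_derivative[OF bounded_linear_fst]
    note snd' = bounded_linear.has_vector_derivative[OF bounded_linear_snd]
    note 1 = fst'[OF y'[OF t]] and 2 = snd'[OF y'[OF t]]
    show "(A has_real_derivative A' t) (at t within ?J)"
      "(B has_real_derivative B' t) (at t within ?J)"
      "(A' has_real_derivative radial_force \<gamma> \<xi> \<Lambda> (A t) (B t)) (at t within ?J)"
      "(B' has_real_derivative axial_force \<gamma> \<Lambda> (A t) (B t)) (at t within ?J)"
      using fst'[OF 1] snd'[OF 1] fst'[OF 2] snd'[OF 2]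
      by (auto simp: has_real_derivative_iff_has_vector_derivative emden_field_def
          A_def[abs_def] B_def[abs_def] A'_def[abs_def] B'_def[abs_def])
  qed
  have "emden_solution \<gamma> \<xi> \<Lambda> a0 a1 b0 b1 (ereal (\<tau> + h)) A A' B B'"
    unfolding emden_solution_def forward_interval_ereal
  proof (intro conjI ballI)
    show "A 0 = a0" "A' 0 = a1" "B 0 = b0" "B' 0 = b1"
      using y(2)[of 0] D(1-5) by (auto simp: A_def B_def A'_def B'_def x_def)
    fix t assume t: "t \<in> ?J"
    show "0 < A t" "0 < B t" using y(3)[of t] t by (auto simp: A_def B_def)
    show "(A has_real_derivative A' t) (at t within ?J)"
      "(B has_real_derivative B' t) (at t within ?J)" using ders[OF t] by auto
    show "\<exists>a'' b''. (A' has_real_derivative a'') (at t within ?J) \<and>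
        (B' has_real_derivative b'') (at t within ?J) \<and>
        a'' - \<xi>\<^sup>2 / A t ^ 3 = \<Lambda> / (A t powr (2 * \<gamma> - 1) * B t powr (\<gamma> - 1)) \<and>
        b'' = \<Lambda> / (A t powr (2 * \<gamma> - 2) * B t powr \<gamma>)"
      using ders(3,4)[OF t] unfolding radial_force_def axial_force_def
      by (intro exI conjI) (assumption | simp)+
  qed (use D(1) y(1) in auto)
  moreover have "\<forall>t\<in>forward_interval (ereal \<tau>). A t = a t \<and> B t = b t"
    using y(2) by (auto simp: A_def B_def x_def)
  moreover have "ereal \<tau> < ereal (\<tau> + h)" using y(1) by simp
  ultimately show False using max unfolding maximal_emden_solution_def by blast
qed

section \<open>The conserved energy\<close>

text \<open>The powers recombine because \<open>(x\<^sup>2 * y) powr (\<gamma> - 1)\<close> splits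
  into \<open>x powr (2 * \<gamma> - 2) * y powr (\<gamma> - 1)\<close>. All real exponents now sit
  in one common factor, which later calculations abbreviate to \<open>e\<close> and treat as an
  opaque constant.\<close>

lemma forces_via_volume:
  assumes "0 < x" "0 < y"
  shows "radial_force \<gamma> \<xi> \<Lambda> x y = \<xi>\<^sup>2 / x ^ 3 + \<Lambda> / ((x\<^sup>2 * y) powr (\<gamma> - 1) * x)"
    and "axial_force \<gamma> \<Lambda> x y = \<Lambda> / ((x\<^sup>2 * y) powr (\<gamma> - 1) * y)"
proof -
  have e: "(x\<^sup>2 * y) powr (\<gamma> - 1) = x powr (2 * \<gamma> - 2) * y powr (\<gamma> - 1)"
  proof -
    have "x\<^sup>2 = x powr 2" using assms by simp
    then have "(x\<^sup>2) powr (\<gamma> - 1) = x powr (2 * (\<gamma> - 1))" by (simp only: powr_powr)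
    then show ?thesis using assms by (simp add: powr_mult right_diff_distrib)
  qed
  have "x powr (2 * \<gamma> - 1) = x powr (2 * \<gamma> - 2) * x" "y powr \<gamma> = y powr (\<gamma> - 1) * y"
    using powr_add[of x "2 * \<gamma> - 2" 1] powr_add[of y "\<gamma> - 1" 1] assms by (auto simp: algebra_simps)
  then have "(x\<^sup>2 * y) powr (\<gamma> - 1) * x = x powr (2 * \<gamma> - 1) * y powr (\<gamma> - 1)"
    "(x\<^sup>2 * y) powr (\<gamma> - 1) * y = x powr (2 * \<gamma> - 2) * y powr \<gamma>"
    unfolding e by (simp_all only: mult_ac)
  then show "radial_force \<gamma> \<xi> \<Lambda> x y = \<xi>\<^sup>2 / x ^ 3 + \<Lambda> / ((x\<^sup>2 * y) powr (\<gamma> - 1) * x)"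
    "axial_force \<gamma> \<Lambda> x y = \<Lambda> / ((x\<^sup>2 * y) powr (\<gamma> - 1) * y)"
    by (simp_all only: radial_force_def axial_force_def)
qed

text \<open>The additive constant makes the energy vanish at \<open>V = 1\<close> for every \<gamma>
  and makes the logarithm the limit as \<gamma> tends to 1.\<close>

definition internal_energy :: "real \<Rightarrow> real \<Rightarrow> real" where
  "internal_energy \<gamma> V = (if \<gamma> = 1 then - ln V else (V powr (1 - \<gamma>) - 1) / (\<gamma> - 1))"

text \<open>In both cases the derivative with respect to \<open>V\<close> is
  \<open>- (V powr (- \<gamma>))\<close>, minus the pressure up to a constant; the denominator is
  written as in \<open>forces_via_volume\<close>.\<close>

lemma internal_energy_deriv [derivative_intros]:
  assumes "0 < V t" "(V has_real_derivative V') (at t within S)"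
  shows "((\<lambda>t. internal_energy \<gamma> (V t)) has_real_derivative - (V' / (V t powr (\<gamma> - 1) * V t))) (at t within S)"
proof (cases "\<gamma> = 1")
  case True
  have "((\<lambda>t. - ln (V t)) has_real_derivative - (V' / V t)) (at t within S)"
    using assms by (auto intro!: derivative_eq_intros)
  then show ?thesis using True assms(1) by (simp add: internal_energy_def)
next
  case False
  define P where "P = V t powr (1 - \<gamma> - 1)"
  have P: "P = 1 / (V t powr (\<gamma> - 1) * V t)"
    using assms(1) powr_add[of "V t" "\<gamma> - 1" 1] by (simp add: P_def powr_minus_divide)
  have "((\<lambda>t. (V t powr (1 - \<gamma>) - 1) / (\<gamma> - 1)) has_real_derivative
      ((1 - \<gamma>) * P * V') / (\<gamma> - 1)) (at t within S)"
    using DERIV_cdivide[OF DERIV_diff[OF DERIV_chain'[OF assms(2) has_real_derivative_powr[OF assms(1)]]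
      DERIV_const]]
    by (simp only: diff_0_right P_def)
  moreover have "(1 - \<gamma>) * P * V' / (\<gamma> - 1) = - (V' * P)" using False by (simp add: field_simps)
  ultimately show ?thesis using False P by (simp add: internal_energy_def)
qed

text \<open>The inequality \<open>1 + x \<le> exp x\<close> at
  \<open>x = (1 - \<gamma>) * ln V\<close>, divided by \<open>\<gamma> - 1\<close>.\<close>

lemma internal_energy_ge:
  assumes "0 < V" "1 \<le> \<gamma>"
  shows "- ln V \<le> internal_energy \<gamma> V"
proof (cases "\<gamma> = 1")
  case False
  have "V powr (1 - \<gamma>) = exp ((1 - \<gamma>) * ln V)" using assms by (simp add: powr_def)
  then have "(1 - \<gamma>) * ln V \<le> V powr (1 - \<gamma>) - 1"
    using exp_ge_add_one_self[of "(1 - \<gamma>) * ln V"] by linarith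
  then show ?thesis using False assms by (simp add: internal_energy_def field_simps)
qed (simp add: internal_energy_def)

text \<open>Multiply the first equation by \<open>2 * a'\<close>, the second by \<open>b'\<close>,
  and add. The centrifugal force cancels against the derivative of
  \<open>(\<xi> / a)\<^sup>2\<close>, and the pressure terms against that of the internal energy,
  because the volume has logarithmic derivative \<open>2 * a' / a + b' / b\<close>.\<close>

lemma emden_energy:
  assumes sol: "emden_solution \<gamma> \<xi> \<Lambda> a0 a1 b0 b1 T a a' b b'"
  obtains E where "\<And>t. t \<in> forward_interval T \<Longrightarrow>
    (a' t)\<^sup>2 + (b' t)\<^sup>2 / 2 + (\<xi> / a t)\<^sup>2 + \<Lambda> * internal_energy \<gamma> ((a t)\<^sup>2 * b t) = E"
proof -
  note D = emden_solutionD[OF sol]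
  have "\<exists>E. \<forall>t\<in>forward_interval T.
    (a' t)\<^sup>2 + (b' t)\<^sup>2 / 2 + (\<xi> / a t)\<^sup>2 + \<Lambda> * internal_energy \<gamma> ((a t)\<^sup>2 * b t) = E"
  proof (rule has_field_derivative_zero_constant[OF convex_forward_interval])
    fix t assume t: "t \<in> forward_interval T"
    note pos = D(6,7)[OF t]
    define e where "e = ((a t)\<^sup>2 * b t) powr (\<gamma> - 1)"
    have e: "e \<noteq> 0" using pos by (simp add: e_def)
    show "((\<lambda>t. (a' t)\<^sup>2 + (b' t)\<^sup>2 / 2 + (\<xi> / a t)\<^sup>2 + \<Lambda> * internal_energy \<gamma> ((a t)\<^sup>2 * b t))
      has_real_derivative 0) (at t within forward_interval T)"
      apply (rule derivative_eq_intros D(8-11) t refl | (use pos in simp; fail))+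
      unfolding forces_via_volume[OF pos] e_def[symmetric]
      using pos e by (simp add: field_simps power2_eq_square power3_eq_cube)
  qed
  then show ?thesis using that by auto
qed

section \<open>Global existence\<close>

lemma emden_global:
  assumes max: "maximal_emden_solution \<gamma> \<xi> \<Lambda> a0 a1 b0 b1 T a a' b b'"
    and "1 \<le> \<gamma>" "\<xi> \<noteq> 0" and \<Lambda>: "0 < \<Lambda> \<or> \<Lambda> = 0 \<and> 0 \<le> b1"
  shows "T = \<infinity>"
proof (rule ccontr)
  assume "T \<noteq> \<infinity>"
  have sol: "emden_solution \<gamma> \<xi> \<Lambda> a0 a1 b0 b1 T a a' b b'"
    using max by (simp add: maximal_emden_solution_def)
  with \<open>T \<noteq> \<infinity>\<close> obtain \<tau> where \<tau>: "T = ereal \<tau>"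
    by (cases T) (auto simp: emden_solution_def)
  note D = emden_solutionD[OF sol[unfolded \<tau>], simplified]
  let ?I = "{0..<\<tau>}"
  have \<Lambda>0: "0 \<le> \<Lambda>" using \<Lambda> by auto
  obtain E where E: "\<And>t. t \<in> ?I \<Longrightarrow>
      (a' t)\<^sup>2 + (b' t)\<^sup>2 / 2 + (\<xi> / a t)\<^sup>2 + \<Lambda> * internal_energy \<gamma> ((a t)\<^sup>2 * b t) = E"
    using emden_energy[OF sol] \<tau> by auto
  have en: "(a' t)\<^sup>2 + (b' t)\<^sup>2 / 2 + (\<xi> / a t)\<^sup>2 \<le> E + \<Lambda> * (2 * ln (a t) + ln (b t))"
    if t: "t \<in> ?I" for t
  proof -
    have "\<Lambda> * (- ln ((a t)\<^sup>2 * b t)) \<le> \<Lambda> * internal_energy \<gamma> ((a t)\<^sup>2 * b t)"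
      using D(6,7)[of t] t \<open>1 \<le> \<gamma>\<close> \<Lambda>0 by (intro mult_left_mono internal_energy_ge) auto
    moreover have "ln ((a t)\<^sup>2 * b t) = 2 * ln (a t) + ln (b t)"
      using D(6,7)[of t] t by (simp add: ln_mult ln_realpow)
    ultimately show ?thesis using E[OF t] by (simp add: algebra_simps)
  qed
  \<comment> \<open>The part \<open>2 * \<Lambda>\<close> absorbs both logarithms through
    \<open>ln x \<le> x - 1\<close>; the rest absorbs \<open>E\<close> and keeps \<open>C\<close>
    positive.\<close>
  define C where "C = \<bar>E\<bar> + 2 * \<Lambda> + 1"
  have C: "0 < C" using \<Lambda>0 by (simp add: C_def)
  have en2: "(a' t)\<^sup>2 + (b' t)\<^sup>2 / 2 + (\<xi> / a t)\<^sup>2 \<le> C * (1 + a t + b t)" if t: "t \<in> ?I" for t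
  proof -
    have pos: "0 < a t" "0 < b t" using D(6,7)[of t] t by auto
    have "\<Lambda> * (2 * ln (a t) + ln (b t)) \<le> \<Lambda> * (2 * (1 + a t + b t))"
      using ln_le_minus_one[OF pos(1)] ln_le_minus_one[OF pos(2)] pos \<Lambda>0
      by (intro mult_left_mono) auto
    moreover have "E \<le> (\<bar>E\<bar> + 1) * (1 + a t + b t)"
      using mult_mono[of "\<bar>E\<bar>" "\<bar>E\<bar> + 1" 1 "1 + a t + b t"] pos by auto
    ultimately show ?thesis using en[OF t] by (simp add: C_def algebra_simps)
  qed
  \<comment> \<open>This is the bound that \<open>sqrt_growth_bound\<close> gives for
    \<open>1 + a + b\<close> with \<open>c = sqrt C\<close>.\<close>
  define R where "R = (sqrt (1 + a 0 + b 0) + sqrt C * \<tau>)\<^sup>2"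
  have G: "1 + a t + b t \<le> R" if t: "t \<in> ?I" for t
    unfolding R_def
  proof (rule sqrt_growth_bound[where G = "\<lambda>t. 1 + a t + b t" and G' = "\<lambda>t. a' t + b' t", OF t])
    fix s assume s: "s \<in> ?I"
    show "((\<lambda>t. 1 + a t + b t) has_real_derivative a' s + b' s) (at s within ?I)"
      using D(8,9)[of s] s by (auto intro!: derivative_eq_intros)
    have pos: "0 < a s" "0 < b s" using D(6,7)[of s] s by auto
    show "0 < 1 + a s + b s" using pos by simp
    \<comment> \<open>Four times the kinetic energy exceeds the square of \<open>a' + b'\<close> by
      a sum of squares.\<close>
    have "4 * ((a' s)\<^sup>2 + (b' s)\<^sup>2 / 2) = (a' s + b' s)\<^sup>2 + (a' s - b' s)\<^sup>2 + 2 * (a' s)\<^sup>2"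
      by (simp add: power2_eq_square algebra_simps)
    then have "(a' s + b' s)\<^sup>2 \<le> 4 * ((a' s)\<^sup>2 + (b' s)\<^sup>2 / 2)"
      using zero_le_power2[of "a' s - b' s"] zero_le_power2[of "a' s"] by linarith
    also have "\<dots> \<le> 4 * (C * (1 + a s + b s))"
      by (intro mult_left_mono order_trans[OF _ en2[OF s]]) simp_all
    finally have "a' s + b' s \<le> sqrt (4 * (C * (1 + a s + b s)))" by (rule real_le_rsqrt)
    then show "a' s + b' s \<le> 2 * sqrt C * sqrt (1 + a s + b s)"
      by (simp add: real_sqrt_mult)
  qed (use C in simp)
  have R: "1 < R" using G[of 0] D(1) D(6,7)[of 0] by auto
  have kin: "(a' t)\<^sup>2 + (b' t)\<^sup>2 / 2 + (\<xi> / a t)\<^sup>2 \<le> C * R" if t: "t \<in> ?I" for t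
    using en2[OF t] mult_left_mono[OF G[OF t] less_imp_le[OF C]] by linarith
  \<comment> \<open>Here the two admissible cases differ. For \<open>\<Lambda> = 0\<close> the
    velocity \<open>b'\<close> is constant and nonnegative; for \<open>\<Lambda> > 0\<close> the
    energy inequality bounds \<open>ln b\<close> from below once \<open>a\<close> is bounded
    above.\<close>
  obtain m where m: "0 < m" "\<And>t. t \<in> ?I \<Longrightarrow> m \<le> b t"
  proof (cases "\<Lambda> = 0")
    case True
    then have b1: "0 \<le> b1" using \<Lambda> by simp
    have "b' t = b1" if t: "t \<in> ?I" for t
    proof -
      obtain c where "\<forall>t\<in>?I. b' t = c"
        using has_field_derivative_zero_constant[of ?I b'] D(11) True by (auto simp: axial_force_def)
      then show ?thesis using D(1,5) t by auto
    qed
    then have "- b t \<le> - b 0 + 0 * (t - 0)" if t: "t \<in> ?I" for t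
      using that D(9) b1
      by (intro derivative_le_imp_linear_bound[where J = ?I and f' = "\<lambda>t. - b' t"])
         (auto intro!: derivative_eq_intros)
    then show ?thesis using that[of "b 0"] D(1) D(7)[of 0] by auto
  next
    case False
    then have "0 < \<Lambda>" using \<Lambda>0 by simp
    have "exp (- E / \<Lambda> - 2 * ln R) \<le> b t" if t: "t \<in> ?I" for t
    proof -
      have pos: "0 < a t" "0 < b t" using D(6,7)[of t] t by auto
      have "0 \<le> (a' t)\<^sup>2 + (b' t)\<^sup>2 / 2 + (\<xi> / a t)\<^sup>2" by simp
      then have "0 \<le> E + \<Lambda> * (2 * ln (a t) + ln (b t))" using en[OF t] by linarith
      then have "- E / \<Lambda> - 2 * ln (a t) \<le> ln (b t)"
        using \<open>0 < \<Lambda>\<close> by (simp add: field_simps)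
      moreover have "ln (a t) \<le> ln R" using pos G[OF t] by simp
      ultimately have "- E / \<Lambda> - 2 * ln R \<le> ln (b t)" by linarith
      then show ?thesis using pos by (simp add: ln_ge_iff)
    qed
    then show ?thesis using that[of "exp (- E / \<Lambda> - 2 * ln R)"] by auto
  qed
  \<comment> \<open>Solving \<open>(\<xi> / a)\<^sup>2 \<le> C * R\<close> for \<open>a\<close>
    gives this lower bound, which is positive because \<open>\<xi> \<noteq> 0\<close>.\<close>
  define l where "l = \<bar>\<xi>\<bar> / sqrt (C * R)"
  have CR: "0 < C * R" using C R by simp
  have la: "l \<le> a t" if t: "t \<in> ?I" for t
  proof -
    have pos: "0 < a t" using D(6)[of t] t by auto
    have "(\<xi> / a t)\<^sup>2 \<le> C * R"
      using kin[OF t] zero_le_power2[of "a' t"] zero_le_power2[of "b' t"] by linarith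
    then have "\<bar>\<xi>\<bar> / a t \<le> sqrt (C * R)"
      using pos by (intro real_le_rsqrt) (simp add: power_divide)
    then show ?thesis using pos CR unfolding l_def by (simp add: field_simps)
  qed
  define u where "u = R + sqrt (2 * (C * R))"
  have s0: "0 \<le> sqrt (2 * (C * R))" using CR by simp
  have "\<bar>a' t\<bar> \<le> u \<and> \<bar>b' t\<bar> \<le> u \<and> a t \<le> u \<and> b t \<le> u" if t: "t \<in> ?I" for t
  proof -
    have "(a' t)\<^sup>2 \<le> 2 * (C * R)" "(b' t)\<^sup>2 \<le> 2 * (C * R)"
      using kin[OF t] zero_le_power2[of "a' t"] zero_le_power2[of "b' t"] zero_le_power2[of "\<xi> / a t"] CR
      by linarith+
    then have "\<bar>a' t\<bar> \<le> sqrt (2 * (C * R))" "\<bar>b' t\<bar> \<le> sqrt (2 * (C * R))"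
      by (auto intro: real_le_rsqrt)
    moreover have "0 < a t" "0 < b t" using D(6,7)[of t] t by auto
    ultimately show ?thesis using G[OF t] R s0 unfolding u_def by auto
  qed
  moreover have "0 < min l m" using m CR \<open>\<xi> \<noteq> 0\<close> by (simp add: l_def)
  ultimately show False
    using maximal_emden_solution_unbounded[OF max[unfolded \<tau>], of "min l m" u] la m(2) by fastforce
qed

section \<open>Blow-up in finite time\<close>

text \<open>The linear bound forces \<open>b\<close> down to 0 by the time
  \<open>s + b s / d\<close>, against its positivity for all times.\<close>

lemma not_eventually_decreasing:
  assumes sol: "emden_solution \<gamma> \<xi> \<Lambda> a0 a1 b0 b1 \<infinity> a a' b b'"
    and "0 \<le> s" "0 < d" and dec: "\<And>t. s \<le> t \<Longrightarrow> b' t \<le> - d"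
  shows False
proof -
  note D = emden_solutionD[OF sol, simplified]
  define t where "t = s + b s / d"
  have pos: "0 < b s" using D(7) \<open>0 \<le> s\<close> by simp
  then have st: "s \<le> t" using \<open>0 < d\<close> by (simp add: t_def)
  have "b t \<le> b s + (- d) * (t - s)"
    using st \<open>0 \<le> s\<close> D(9) dec by (intro derivative_le_imp_linear_bound[where J = "{0..}" and f' = b']) auto
  then have "b t \<le> 0" using \<open>0 < d\<close> by (simp add: t_def)
  then show False using D(7)[of t] st \<open>0 \<le> s\<close> by simp
qed

lemma emden_blowup_free:
  assumes sol: "emden_solution \<gamma> \<xi> 0 a0 a1 b0 b1 T a a' b b'" and "b1 < 0"
  shows "T < \<infinity>"
proof (rule ccontr)
  assume "\<not> T < \<infinity>"
  then have T: "T = \<infinity>" by simp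
  note D = emden_solutionD[OF sol[unfolded T], simplified]
  have "b' t \<le> b1" if "0 \<le> t" for t
    using derivative_le_imp_linear_bound[of 0 t "{0..}" b' "\<lambda>_. 0" 0] that D(5,11)
    by (auto simp: axial_force_def)
  then show False
    using not_eventually_decreasing[OF sol[unfolded T], of 0 "- b1"] \<open>b1 < 0\<close> by auto
qed

lemma emden_blowup_attractive:
  assumes sol: "emden_solution \<gamma> \<xi> \<Lambda> a0 a1 b0 b1 T a a' b b'" and "\<Lambda> < 0" "b1 \<le> 0"
  shows "T < \<infinity>"
proof (rule ccontr)
  assume "\<not> T < \<infinity>"
  then have T: "T = \<infinity>" by simp
  note D = emden_solutionD[OF sol[unfolded T], simplified]
  have neg: "axial_force \<gamma> \<Lambda> (a t) (b t) < 0" if "0 \<le> t" for t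
    using D(6,7)[of t] that \<open>\<Lambda> < 0\<close> by (simp add: axial_force_def divide_neg_pos)
  have "b' 1 < b' 0"
    by (rule derivative_neg_imp_less[where J = "{0..}" and f' = "\<lambda>t. axial_force \<gamma> \<Lambda> (a t) (b t)"])
       (use D(11) neg in auto)
  then have "b' 1 < 0" using D(5) \<open>b1 \<le> 0\<close> by simp
  moreover have "b' t \<le> b' 1" if "1 \<le> t" for t
  proof -
    have "b' t \<le> b' 1 + 0 * (t - 1)"
      by (rule derivative_le_imp_linear_bound[where J = "{0..}" and f' = "\<lambda>t. axial_force \<gamma> \<Lambda> (a t) (b t)"])
         (use that D(11) neg in \<open>auto intro: less_imp_le\<close>)
    then show ?thesis by simp
  qed
  ultimately show False
    using not_eventually_decreasing[OF sol[unfolded T], of 1 "- b' 1"] by auto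
qed

text \<open>For \<open>\<gamma> = 1\<close> the equation for \<open>b\<close> decouples from
  \<open>a\<close> and has its own conserved energy. This bounds \<open>b\<close> above whatever the
  sign of \<open>b1\<close>, so the deceleration is uniform and finally outweighs any initial
  velocity.\<close>

lemma emden_blowup_isothermal:
  assumes sol: "emden_solution 1 \<xi> \<Lambda> a0 a1 b0 b1 T a a' b b'" and "\<Lambda> < 0"
  shows "T < \<infinity>"
proof (rule ccontr)
  assume "\<not> T < \<infinity>"
  then have T: "T = \<infinity>" by simp
  note D = emden_solutionD[OF sol[unfolded T], simplified]
  have force: "axial_force 1 \<Lambda> (a t) (b t) = \<Lambda> / b t" if "0 \<le> t" for t
    using D(6,7)[of t] that by (simp add: axial_force_def)
  have "\<exists>E. \<forall>t\<in>{0..}. (b' t)\<^sup>2 / 2 - \<Lambda> * ln (b t) = E"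
  proof (rule has_field_derivative_zero_constant)
    fix t :: real assume t: "t \<in> {0..}"
    show "((\<lambda>t. (b' t)\<^sup>2 / 2 - \<Lambda> * ln (b t)) has_real_derivative 0) (at t within {0..})"
      using t D(7)[of t] D(9)[of t] D(11)[of t] force[of t] by (auto intro!: derivative_eq_intros)
  qed simp
  then obtain E where E: "\<And>t. 0 \<le> t \<Longrightarrow> (b' t)\<^sup>2 / 2 - \<Lambda> * ln (b t) = E" by auto
  \<comment> \<open>Dropping the square from the conserved quantity and solving for \<open>b\<close>
    gives this bound, since \<open>- \<Lambda>\<close> is positive.\<close>
  define B where "B = exp (E / (- \<Lambda>))"
  have B: "b t \<le> B" if "0 \<le> t" for t
  proof -
    have "- \<Lambda> * ln (b t) \<le> E" using E[OF that] zero_le_power2[of "b' t"] by linarith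
    then have "ln (b t) \<le> E / (- \<Lambda>)" using \<open>\<Lambda> < 0\<close> by (simp add: field_simps)
    then show ?thesis unfolding B_def using D(7)[of t] that by (metis atLeast_iff exp_le_cancel_iff exp_ln)
  qed
  define c where "c = - \<Lambda> / B"
  have c: "0 < c" using \<open>\<Lambda> < 0\<close> by (simp add: c_def B_def divide_neg_pos)
  have b': "b' t \<le> b1 + (- c) * (t - 0)" if t: "0 \<le> t" for t
    unfolding D(5)[symmetric]
  proof (rule derivative_le_imp_linear_bound[where J = "{0..}"])
    fix s assume "s \<in> {0..t}"
    then have s: "0 \<le> s" by simp
    show "(b' has_real_derivative \<Lambda> / b s) (at s within {0..})" using D(11)[of s] force s by simp
    have "- \<Lambda> / B \<le> - \<Lambda> / b s"
      using B[OF s] D(7)[of s] s \<open>\<Lambda> < 0\<close> by (intro divide_left_mono) (auto simp: B_def)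
    then show "\<Lambda> / b s \<le> - c" by (simp add: c_def)
  qed (use t in auto)
  \<comment> \<open>From this threshold on, the linear bound \<open>b1 - c * t\<close> is at most
    -1; the absolute value also makes the threshold positive.\<close>
  have "b' t \<le> - 1" if t: "(\<bar>b1\<bar> + 1) / c \<le> t" for t
  proof -
    have "\<bar>b1\<bar> + 1 \<le> c * t" using t c by (simp add: field_simps)
    moreover have "0 \<le> t" using t c by (smt (verit) divide_pos_pos)
    ultimately show ?thesis using b'[of t] by auto
  qed
  then show False
    using not_eventually_decreasing[OF sol[unfolded T], of "(\<bar>b1\<bar> + 1) / c" 1] c by auto
qed

section \<open>The Euler equations\<close>

definition pos_powr :: "real \<Rightarrow> real \<Rightarrow> real" where
  "pos_powr m w = (if w \<le> 0 then 0 else w powr m)"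

text \<open>Away from 0 the function is locally a power or constant. At 0 the difference quotient is
  bounded by \<open>\<bar>h\<bar> powr (m - 1)\<close>, which tends to 0 because
  \<open>1 < m\<close>.\<close>

lemma pos_powr_deriv:
  assumes "w \<noteq> 0 \<or> 1 < m"
  shows "(pos_powr m has_real_derivative m * pos_powr (m - 1) w) (at w)"
proof -
  consider "0 < w" | "w < 0" | "w = 0" "1 < m" using assms by linarith
  then show ?thesis
  proof cases
    case 1
    have "((\<lambda>w. w powr m) has_real_derivative m * w powr (m - 1)) (at w)"
      using 1 by (rule has_real_derivative_powr)
    then have "(pos_powr m has_real_derivative m * w powr (m - 1)) (at w)"
      by (rule has_field_derivative_transform_within_open[where S = "{0<..}"])
         (use 1 in \<open>auto simp: pos_powr_def\<close>)
    then show ?thesis using 1 by (simp add: pos_powr_def)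
  next
    case 2
    have "((\<lambda>w. 0) has_real_derivative 0) (at w)" by simp
    then have "(pos_powr m has_real_derivative 0) (at w)"
      by (rule has_field_derivative_transform_within_open[where S = "{..<0}"])
         (use 2 in \<open>auto simp: pos_powr_def\<close>)
    then show ?thesis using 2 by (simp add: pos_powr_def)
  next
    case 3
    have "((\<lambda>h. (pos_powr m (0 + h) - pos_powr m 0) / h) \<longlongrightarrow> 0) (at 0)"
    proof (rule Lim_null_comparison)
      show "((\<lambda>h. \<bar>h\<bar> powr (m - 1)) \<longlongrightarrow> 0) (at (0::real))"
        by (rule tendsto_zero_powrI[where b = "m - 1"]) (use 3 in \<open>auto intro!: tendsto_eq_intros\<close>)
      have "norm ((pos_powr m (0 + h) - pos_powr m 0) / h) \<le> \<bar>h\<bar> powr (m - 1)" if "h \<noteq> 0" for h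
      proof (cases "0 < h")
        case True
        then show ?thesis by (simp add: pos_powr_def powr_diff)
      next
        case False
        then show ?thesis by (simp add: pos_powr_def)
      qed
      then show "\<forall>\<^sub>F h in at 0. norm ((pos_powr m (0 + h) - pos_powr m 0) / h) \<le> \<bar>h\<bar> powr (m - 1)"
        by (auto simp: eventually_at_filter)
    qed
    then show ?thesis using 3 by (simp add: DERIV_def pos_powr_def)
  qed
qed

definition profile_arg :: "real \<Rightarrow> real \<Rightarrow> real \<Rightarrow> real \<Rightarrow> real \<Rightarrow> real" where
  "profile_arg K \<gamma> \<Lambda> \<alpha> s = - (\<Lambda> * (\<gamma> - 1) / (2 * K * \<gamma>)) * s + \<alpha>"

lemma profile_isothermal: "profile K 1 \<Lambda> \<alpha> s = \<alpha> * exp (- \<Lambda> / (2 * K) * s)"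
  by (simp add: profile_def)

lemma profile_polytropic:
  "\<gamma> \<noteq> 1 \<Longrightarrow> profile K \<gamma> \<Lambda> \<alpha> s = pos_powr (1 / (\<gamma> - 1)) (profile_arg K \<gamma> \<Lambda> \<alpha> s)"
  by (simp add: profile_def pos_powr_def profile_arg_def Let_def)

lemma profile_nonneg: "0 \<le> \<alpha> \<Longrightarrow> 0 \<le> profile K \<gamma> \<Lambda> \<alpha> s"
  by (cases "\<gamma> = 1") (auto simp: profile_isothermal profile_polytropic pos_powr_def)

lemma profile_arg_deriv:
  "(profile_arg K \<gamma> \<Lambda> \<alpha> has_real_derivative - (\<Lambda> * (\<gamma> - 1) / (2 * K * \<gamma>))) (at s)"
  unfolding profile_arg_def[abs_def] 
  by (rule DERIV_cong[OF DERIV_add[OF DERIV_cmult_Id DERIV_const]]) simp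

lemma profile_isothermal_deriv:
  "(profile K 1 \<Lambda> \<alpha> has_real_derivative - (\<Lambda> / (2 * K)) * profile K 1 \<Lambda> \<alpha> s) (at s)"
  unfolding profile_isothermal[abs_def]
  by (rule DERIV_cong[OF DERIV_cmult[OF DERIV_chain'[OF DERIV_cmult_Id DERIV_exp]]]) simp

text \<open>For \<open>1 < \<gamma> < 2\<close> the exponent \<open>1 / (\<gamma> - 1)\<close>
  exceeds 1, so a zero of the base is harmless; for larger \<gamma> such zeros have to be
  excluded.\<close>

lemma profile_differentiable:
  assumes "1 \<le> \<gamma>" "\<gamma> < 2 \<or> profile_arg K \<gamma> \<Lambda> \<alpha> s \<noteq> 0"
  obtains d where "(profile K \<gamma> \<Lambda> \<alpha> has_real_derivative d) (at s)"
proof (cases "\<gamma> = 1")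
  case True
  show ?thesis
    using that profile_isothermal_deriv True by blast
next
  case False
  then have "profile_arg K \<gamma> \<Lambda> \<alpha> s \<noteq> 0 \<or> 1 < 1 / (\<gamma> - 1)" using assms by (auto simp: field_simps)
  note DERIV_chain'[OF profile_arg_deriv pos_powr_deriv[OF this]]
  moreover have "profile K \<gamma> \<Lambda> \<alpha> = (\<lambda>s. pos_powr (1 / (\<gamma> - 1)) (profile_arg K \<gamma> \<Lambda> \<alpha> s))"
    using False by (simp add: profile_polytropic fun_eq_iff)
  ultimately show ?thesis using that by simp
qed

text \<open>For \<open>\<gamma> > 1\<close> the exponents \<open>\<gamma> / (\<gamma> - 1)\<close>
  and \<open>1 / (\<gamma> - 1)\<close> differ by exactly 1, so differentiating the pressure profile
  gives back the density profile. The larger exponent exceeds 1, which covers the zeros of the base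
  as well.\<close>

lemma profile_powr_deriv:
  assumes "0 < K" "1 \<le> \<gamma>" "0 \<le> \<alpha>"
  shows "((\<lambda>s. profile K \<gamma> \<Lambda> \<alpha> s powr \<gamma>) has_real_derivative
    - (\<Lambda> / (2 * K)) * profile K \<gamma> \<Lambda> \<alpha> s) (at s)"
proof (cases "\<gamma> = 1")
  case True
  have "profile K 1 \<Lambda> \<alpha> s powr 1 = profile K 1 \<Lambda> \<alpha> s" for s
    using profile_nonneg[OF assms(3)] by simp
  then show ?thesis using profile_isothermal_deriv True by simp
next
  case False
  define m where "m = 1 / (\<gamma> - 1)"
  have g: "1 < \<gamma>" using False assms by simp
  have eq: "profile K \<gamma> \<Lambda> \<alpha> s powr \<gamma> = pos_powr (\<gamma> * m) (profile_arg K \<gamma> \<Lambda> \<alpha> s)" for s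
    using False by (simp add: profile_polytropic pos_powr_def powr_powr m_def)
  have m: "\<gamma> * m - 1 = m" "1 < \<gamma> * m" using g by (auto simp: m_def field_simps)
  have c: "(\<gamma> * m * X) * - (\<Lambda> * (\<gamma> - 1) / (2 * K * \<gamma>)) = - (\<Lambda> / (2 * K)) * X" for X
    using g assms(1) by (simp add: m_def field_simps)
  have "((\<lambda>s. pos_powr (\<gamma> * m) (profile_arg K \<gamma> \<Lambda> \<alpha> s)) has_real_derivative
      (\<gamma> * m * pos_powr m (profile_arg K \<gamma> \<Lambda> \<alpha> s)) * - (\<Lambda> * (\<gamma> - 1) / (2 * K * \<gamma>))) (at s)"
    using DERIV_chain'[OF profile_arg_deriv pos_powr_deriv, of _ _ _ _ _ "\<gamma> * m"] m by metis
  then show ?thesis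
    unfolding c eq using False by (simp add: profile_polytropic m_def)
qed

section \<open>Verification of the continuity and momentum equations\<close>

definition similarity_variable :: "real \<Rightarrow> real \<Rightarrow> real^3 \<Rightarrow> real" where
  "similarity_variable x y p = ((p$1)\<^sup>2 + (p$2)\<^sup>2) / x\<^sup>2 + (p$3)\<^sup>2 / y\<^sup>2"

definition similarity_gradient :: "real \<Rightarrow> real \<Rightarrow> real^3 \<Rightarrow> real^3" where
  "similarity_gradient x y p = vector [2 * p$1 / x\<^sup>2, 2 * p$2 / x\<^sup>2, 2 * p$3 / y\<^sup>2]"

lemma vec_nth_has_derivative [derivative_intros]:
  "((\<lambda>q. q $ i) has_derivative (\<lambda>h. h $ i)) F"
  by (rule bounded_linear_imp_has_derivative) (rule bounded_linear_vec_nth)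

lemma similarity_variable_deriv:
  "(similarity_variable x y has_derivative (\<lambda>h. h \<bullet> similarity_gradient x y p)) (at p)"
  unfolding similarity_variable_def[abs_def] divide_inverse
  by (rule derivative_eq_intros refl | simp)+
     (auto simp: fun_eq_iff similarity_gradient_def inner_vec_def sum_3 vector_3 divide_inverse algebra_simps power2_eq_square)

lemma gas_density_alt:
  "gas_density K \<gamma> \<Lambda> \<alpha> a b t p =
    profile K \<gamma> \<Lambda> \<alpha> (similarity_variable (a t) (b t) p) / ((a t)\<^sup>2 * b t)"
  by (simp add: gas_density_def similarity_variable_def)

text \<open>Radial expansion, rotation and axial stretching, each with a coefficient depending on
  time only. The time derivative of the velocity thus reduces to those of three scalar
  functions.\<close>

lemma velocity_alt:
  "velocity \<xi> a a' b b' t p = (a' t / a t) *\<^sub>R vector [p$1, p$2, 0]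
    + (\<xi> / (a t)\<^sup>2) *\<^sub>R vector [- p$2, p$1, 0] + (b' t / b t) *\<^sub>R vector [0, 0, p$3]"
  by (simp add: velocity_def vec_eq_iff forall_3 vector_3)

lemma linear_velocity: "linear (velocity \<xi> a a' b b' t)"
  by (rule linearI) (simp_all add: velocity_def vec_eq_iff forall_3 vector_3 algebra_simps add_divide_distrib)

text \<open>A linear field is its own derivative, so the convective term is the velocity map applied
  twice.\<close>

lemma velocity_has_derivative:
  "(velocity \<xi> a a' b b' t has_derivative velocity \<xi> a a' b b' t) F"
  using linear_velocity linear_conv_bounded_linear bounded_linear_imp_has_derivative by blast

text \<open>The similarity variable is transported by the flow, and the divergence of the velocity
  is the logarithmic derivative of the volume \<open>a\<^sup>2 * b\<close>. Hence the profile
  divided by that volume is a conserved density.\<close>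

lemma euler_continuity_equation:
  assumes sol: "emden_solution \<gamma> \<xi> \<Lambda> a0 a1 b0 b1 T a a' b b'" and t: "t \<in> forward_interval T"
    and d: "(profile K \<gamma> \<Lambda> \<alpha> has_real_derivative d) (at (similarity_variable (a t) (b t) p))"
  shows "\<exists>r m. ((\<lambda>\<tau>. gas_density K \<gamma> \<Lambda> \<alpha> a b \<tau> p) has_real_derivative r) (at t within forward_interval T) \<and>
    has_divergence (\<lambda>q. gas_density K \<gamma> \<Lambda> \<alpha> a b t q *\<^sub>R velocity \<xi> a a' b b' t q) m p \<and> r + m = 0"
proof -
  note D = emden_solutionD[OF sol]
  note pos = D(6,7)[OF t] and der = D(8,9)[OF t]
  let ?\<rho> = "gas_density K \<gamma> \<Lambda> \<alpha> a b" and ?u = "velocity \<xi> a a' b b'"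
  let ?f = "profile K \<gamma> \<Lambda> \<alpha> (similarity_variable (a t) (b t) p)"
  let ?V = "(a t)\<^sup>2 * b t"
  define s' where "s' = - 2 * (((p$1)\<^sup>2 + (p$2)\<^sup>2) * a' t / a t ^ 3 + (p$3)\<^sup>2 * b' t / b t ^ 3)"
  define V' where "V' = 2 * a t * a' t * b t + (a t)\<^sup>2 * b' t"
  have "((\<lambda>\<tau>. similarity_variable (a \<tau>) (b \<tau>) p) has_real_derivative s') (at t within forward_interval T)"
    unfolding similarity_variable_def
    by (rule derivative_eq_intros der refl | (use pos in simp; fail))+
       (use pos in \<open>simp add: s'_def field_simps power2_eq_square power3_eq_cube\<close>)
  from DERIV_chain'[OF this d]
  have f': "((\<lambda>\<tau>. profile K \<gamma> \<Lambda> \<alpha> (similarity_variable (a \<tau>) (b \<tau>) p)) has_real_derivative d * s')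
      (at t within forward_interval T)" .
  have V': "((\<lambda>\<tau>. (a \<tau>)\<^sup>2 * b \<tau>) has_real_derivative V') (at t within forward_interval T)"
    using der by (auto intro!: derivative_eq_intros simp: V'_def)
  have "((\<lambda>\<tau>. ?\<rho> \<tau> p) has_real_derivative (d * s' * ?V - ?f * V') / (?V * ?V)) (at t within forward_interval T)"
    unfolding gas_density_alt by (rule DERIV_divide[OF f' V']) (use pos in simp)
  moreover
  define \<rho>' where "\<rho>' h = (h \<bullet> similarity_gradient (a t) (b t) p) * d / ?V" for h
  have "(?\<rho> t has_derivative \<rho>') (at p)"
    unfolding gas_density_alt[abs_def] \<rho>'_def[abs_def]
    by (intro bounded_linear.has_derivative[OF bounded_linear_divide] DERIV_compose_FDERIV[OF d similarity_variable_deriv])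
  from has_derivative_scaleR[OF this velocity_has_derivative]
  have "((\<lambda>q. ?\<rho> t q *\<^sub>R ?u t q) has_derivative (\<lambda>h. ?\<rho> t p *\<^sub>R ?u t h + \<rho>' h *\<^sub>R ?u t p)) (at p)" .
  then have "has_divergence (\<lambda>q. ?\<rho> t q *\<^sub>R ?u t q)
      (\<Sum>i\<in>UNIV. (?\<rho> t p *\<^sub>R ?u t (axis i 1) + \<rho>' (axis i 1) *\<^sub>R ?u t p) $ i) p"
    unfolding has_divergence_def by blast
  moreover have "(d * s' * ?V - ?f * V') / (?V * ?V)
      + (\<Sum>i\<in>UNIV. (?\<rho> t p *\<^sub>R ?u t (axis i 1) + \<rho>' (axis i 1) *\<^sub>R ?u t p) $ i) = 0"
  proof -
    have "(\<Sum>i\<in>UNIV. (?\<rho> t p *\<^sub>R ?u t (axis i 1)) $ i) = ?f / ?V * (2 * a' t / a t + b' t / b t)"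
      using pos by (simp add: sum_3 velocity_def axis_def gas_density_alt vector_3 field_simps)
    \<comment> \<open>The rotation is orthogonal to the gradient of the similarity variable, so only
      expansion and stretching contribute, and they undo its time derivative
      \<open>s'\<close>.\<close>
    moreover have "(\<Sum>i\<in>UNIV. (\<rho>' (axis i 1) *\<^sub>R ?u t p) $ i) = d / ?V * (- s')"
      using pos
      by (simp add: sum_3 velocity_def \<rho>'_def inner_axis' similarity_gradient_def vector_3 s'_def
          field_simps power2_eq_square power3_eq_cube)
    moreover have "(d * s' * ?V - ?f * V') / (?V * ?V) = d / ?V * s' - ?f / ?V * (2 * a' t / a t + b' t / b t)"
      using pos by (simp add: V'_def field_simps power2_eq_square)
    ultimately show ?thesis by (simp add: sum.distrib)
  qed
  ultimately show ?thesis by blast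
qed

text \<open>Acceleration and pressure gradient are both multiples of the gradient of the similarity
  variable, and the Emden equations make the two coefficients cancel.\<close>

lemma euler_momentum_equation:
  assumes sol: "emden_solution \<gamma> \<xi> \<Lambda> a0 a1 b0 b1 T a a' b b'" and t: "t \<in> forward_interval T"
    and "0 < K" "1 \<le> \<gamma>" "0 \<le> \<alpha>"
  shows "\<exists>u\<^sub>t Du G. ((\<lambda>\<tau>. velocity \<xi> a a' b b' \<tau> p) has_vector_derivative u\<^sub>t) (at t within forward_interval T) \<and>
    (velocity \<xi> a a' b b' t has_derivative Du) (at p) \<and>
    GDERIV (\<lambda>q. gas_density K \<gamma> \<Lambda> \<alpha> a b t q powr \<gamma>) p :> G \<and>
    gas_density K \<gamma> \<Lambda> \<alpha> a b t p *\<^sub>R (u\<^sub>t + Du (velocity \<xi> a a' b b' t p)) + K *\<^sub>R G = 0"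
proof -
  note D = emden_solutionD[OF sol]
  note pos = D(6,7)[OF t] and der = D(8-11)[OF t]
  let ?\<rho> = "gas_density K \<gamma> \<Lambda> \<alpha> a b" and ?u = "velocity \<xi> a a' b b'"
  let ?f = "profile K \<gamma> \<Lambda> \<alpha> (similarity_variable (a t) (b t) p)"
  let ?V = "(a t)\<^sup>2 * b t"
  let ?g = "similarity_gradient (a t) (b t) p"
  define A where "A = radial_force \<gamma> \<xi> \<Lambda> (a t) (b t)"
  define B where "B = axial_force \<gamma> \<Lambda> (a t) (b t)"
  define ut where "ut = (A / a t - (a' t / a t)\<^sup>2) *\<^sub>R vector [p$1, p$2, 0]
    + (- 2 * \<xi> * a' t / a t ^ 3) *\<^sub>R vector [- p$2, p$1, 0]
    + (B / b t - (b' t / b t)\<^sup>2) *\<^sub>R (vector [0, 0, p$3] :: real^3)"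
  have d1: "((\<lambda>t. a' t / a t) has_real_derivative A / a t - (a' t / a t)\<^sup>2) (at t within forward_interval T)"
    and d2: "((\<lambda>t. \<xi> / (a t)\<^sup>2) has_real_derivative - 2 * \<xi> * a' t / a t ^ 3) (at t within forward_interval T)"
    and d3: "((\<lambda>t. b' t / b t) has_real_derivative B / b t - (b' t / b t)\<^sup>2) (at t within forward_interval T)"
    unfolding A_def B_def
    by (rule derivative_eq_intros der refl | (use pos in simp; fail)
        | (use pos in \<open>simp add: field_simps power2_eq_square power3_eq_cube\<close>; fail))+
  have "((\<lambda>\<tau>. ?u \<tau> p) has_vector_derivative ut) (at t within forward_interval T)"
    unfolding velocity_alt ut_def
    by (intro has_vector_derivative_add;
        (rule has_vector_derivative_eq_rhs, rule has_vector_derivative_scaleR,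
        rule d1 d2 d3, rule has_vector_derivative_const, simp))
  moreover have "(?u t has_derivative ?u t) (at p)" by (rule velocity_has_derivative)
  moreover
  define k where "k = - (\<Lambda> / (2 * K)) * ?f / ?V powr \<gamma>"
  have "GDERIV (\<lambda>q. ?\<rho> t q powr \<gamma>) p :> k *\<^sub>R ?g"
  proof -
    have eq: "?\<rho> t q powr \<gamma> = profile K \<gamma> \<Lambda> \<alpha> (similarity_variable (a t) (b t) q) powr \<gamma> / ?V powr \<gamma>" for q
      unfolding gas_density_alt by (rule powr_divide)
    have "((\<lambda>q. profile K \<gamma> \<Lambda> \<alpha> (similarity_variable (a t) (b t) q) powr \<gamma> / ?V powr \<gamma>)
      has_derivative (\<lambda>h. (h \<bullet> ?g) * (- (\<Lambda> / (2 * K)) * ?f) / ?V powr \<gamma>)) (at p)"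
      by (intro bounded_linear.has_derivative[OF bounded_linear_divide]
          DERIV_compose_FDERIV[OF profile_powr_deriv[OF assms(3-5)] similarity_variable_deriv])
    then show ?thesis unfolding gderiv_def eq by (simp add: k_def mult_ac)
  qed
  moreover have "?\<rho> t p *\<^sub>R (ut + ?u t (?u t p)) + K *\<^sub>R (k *\<^sub>R ?g) = 0"
  proof -
    define e where "e = ?V powr (\<gamma> - 1)"
    have e: "e \<noteq> 0" using pos by (simp add: e_def)
    have "?V powr \<gamma> = e * ?V" using pos powr_add[of ?V "\<gamma> - 1" 1] by (simp add: e_def)
    then have k: "K * k = - (\<Lambda> / 2) * ?f / (e * ?V)" using assms(3) by (simp add: k_def)
    have A: "A = \<xi>\<^sup>2 / a t ^ 3 + \<Lambda> / (e * a t)" and B: "B = \<Lambda> / (e * b t)"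
      using forces_via_volume[OF pos] by (auto simp: A_def B_def e_def)
    \<comment> \<open>The centrifugal term in \<open>A\<close> cancels the centripetal acceleration
      of the rotation, and the azimuthal contributions cancel each other; only the terms with
      \<Lambda> remain.\<close>
    have "ut + ?u t (?u t p) = (\<Lambda> / (2 * e)) *\<^sub>R ?g"
      unfolding ut_def A B using pos e
      by (simp add: velocity_def vec_eq_iff forall_3 vector_3 similarity_gradient_def
          field_simps power2_eq_square power3_eq_cube)
    then have "?\<rho> t p *\<^sub>R (ut + ?u t (?u t p)) + K *\<^sub>R (k *\<^sub>R ?g)
        = (?\<rho> t p * (\<Lambda> / (2 * e)) + K * k) *\<^sub>R ?g"
      by (simp add: scaleR_add_left)
    also have "?\<rho> t p * (\<Lambda> / (2 * e)) + K * k = 0"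
      unfolding k using pos e by (simp add: gas_density_alt field_simps)
    finally show ?thesis by simp
  qed
  ultimately show ?thesis by blast
qed

section \<open>The vacuum boundary and the complete Euler system\<close>

lemma gas_density_pos_iff:
  assumes "1 < \<gamma>" "0 < a t" "0 < b t"
  shows "0 < gas_density K \<gamma> \<Lambda> \<alpha> a b t p \<longleftrightarrow>
    0 < profile_arg K \<gamma> \<Lambda> \<alpha> (similarity_variable (a t) (b t) p)"
  using assms by (simp add: gas_density_alt profile_polytropic pos_powr_def zero_less_divide_iff)

text \<open>The density vanishes at \<open>p\<close> together with the base, so it remains to
  approach \<open>p\<close> along a segment of points with positive density.\<close>

lemma vacuum_boundaryI:
  assumes "0 < K" "1 < \<gamma>" "0 < a t" "0 < b t" "0 \<le> \<alpha>" and nontriv: "0 < \<alpha> \<or> \<Lambda> < 0"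
    and zero: "profile_arg K \<gamma> \<Lambda> \<alpha> (similarity_variable (a t) (b t) p) = 0"
  shows "p \<in> vacuum_boundary (gas_density K \<gamma> \<Lambda> \<alpha> a b) t"
proof -
  let ?s = "similarity_variable (a t) (b t)"
  let ?S = "{q. 0 < gas_density K \<gamma> \<Lambda> \<alpha> a b t q}"
  define c where "c = \<Lambda> * (\<gamma> - 1) / (2 * K * \<gamma>)"
  have arg: "profile_arg K \<gamma> \<Lambda> \<alpha> s = \<alpha> - c * s" for s by (simp add: profile_arg_def c_def)
  have S: "q \<in> ?S \<longleftrightarrow> c * ?s q < \<alpha>" for q using gas_density_pos_iff assms(2-4) arg by simp
  have z: "c * ?s p = \<alpha>" using zero arg by simp
  have "\<exists>v. \<forall>\<epsilon>\<in>{0<..<1}. p + \<epsilon> *\<^sub>R v \<in> ?S"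
  proof (cases "0 < \<alpha>")
    case True
    \<comment> \<open>Moving towards the origin multiplies the similarity variable by
      \<open>(1 - \<epsilon>)\<^sup>2\<close>, which lowers \<open>c * ?s\<close> strictly below its
      value \<alpha> at \<open>p\<close>.\<close>
    have "p + \<epsilon> *\<^sub>R (- p) \<in> ?S" if "\<epsilon> \<in> {0<..<1}" for \<epsilon>
    proof -
      have "?s (p + \<epsilon> *\<^sub>R (- p)) = (1 - \<epsilon>)\<^sup>2 * ?s p"
        using assms(3,4) by (simp add: similarity_variable_def field_simps power2_eq_square)
      then have "c * ?s (p + \<epsilon> *\<^sub>R (- p)) = (1 - \<epsilon>)\<^sup>2 * \<alpha>" using z by simp
      moreover have "(1 - \<epsilon>)\<^sup>2 < 1" using that by (simp add: power_less_one_iff abs_square_less_1)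
      ultimately show ?thesis unfolding S using True by simp
    qed
    then show ?thesis by blast
  next
    case False
    then have "\<alpha> = 0" "\<Lambda> < 0" using nontriv assms(5) by auto
    then have c: "c < 0" using assms(1,2) by (simp add: c_def divide_neg_pos mult_neg_pos)
    then have "?s p = 0" using z \<open>\<alpha> = 0\<close> by simp
    then have "p = 0"
      using assms(3,4)
      by (simp add: similarity_variable_def vec_eq_iff forall_3 add_nonneg_eq_0_iff)
    \<comment> \<open>With \<open>c\<close> negative and \<alpha> zero every point other than the
      origin carries gas; the first coordinate direction is an arbitrary choice.\<close>
    have "p + \<epsilon> *\<^sub>R axis 1 1 \<in> ?S" if "\<epsilon> \<in> {0<..<1}" for \<epsilon>
      unfolding S using that c assms(3) \<open>p = 0\<close> \<open>\<alpha> = 0\<close>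
      by (simp add: similarity_variable_def axis_def mult_neg_pos divide_neg_pos)
    then show ?thesis by blast
  qed
  then obtain v where v: "\<And>\<epsilon>. \<epsilon> \<in> {0<..<1} \<Longrightarrow> p + \<epsilon> *\<^sub>R v \<in> ?S" by blast
  have "p \<in> closure ?S"
  proof (rule Lim_in_closed_set)
    show "((\<lambda>\<epsilon>. p + \<epsilon> *\<^sub>R v) \<longlongrightarrow> p) (at_right 0)" by (auto intro!: tendsto_eq_intros)
    have "\<forall>\<^sub>F \<epsilon> in at_right 0. \<epsilon> \<in> {0<..<1::real}"
      by (rule eventually_at_right_real) simp
    then show "\<forall>\<^sub>F \<epsilon> in at_right 0. p + \<epsilon> *\<^sub>R v \<in> closure ?S"
      by eventually_elim (use v closure_subset in blast)
  qed auto
  moreover have "p \<notin> ?S" unfolding S using z by simp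
  ultimately show ?thesis
    unfolding vacuum_boundary_def frontier_def using interior_subset by blast
qed

lemma gas_density_zero:
  assumes "0 < K" "1 < \<gamma>" "0 \<le> \<Lambda>"
  shows "gas_density K \<gamma> \<Lambda> 0 a b t p = 0"
proof -
  have "profile_arg K \<gamma> \<Lambda> 0 (similarity_variable (a t) (b t) p) \<le> 0"
    using assms by (simp add: profile_arg_def similarity_variable_def)
  then show ?thesis using assms by (simp add: gas_density_alt profile_polytropic pos_powr_def)
qed

lemma emden_imp_euler_solution:
  assumes sol: "emden_solution \<gamma> \<xi> \<Lambda> a0 a1 b0 b1 T a a' b b'"
    and "0 < K" "1 \<le> \<gamma>" "0 \<le> \<alpha>"
  shows "euler_solution K \<gamma> T (gas_density K \<gamma> \<Lambda> \<alpha> a b) (velocity \<xi> a a' b b')"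
  unfolding euler_solution_def
proof (intro ballI allI conjI impI)
  fix t p assume t: "t \<in> forward_interval T"
  let ?\<rho> = "gas_density K \<gamma> \<Lambda> \<alpha> a b" and ?u = "velocity \<xi> a a' b b'"
  let ?w = "profile_arg K \<gamma> \<Lambda> \<alpha> (similarity_variable (a t) (b t) p)"
  show "\<exists>u\<^sub>t Du G. ((\<lambda>\<tau>. ?u \<tau> p) has_vector_derivative u\<^sub>t) (at t within forward_interval T) \<and>
      (?u t has_derivative Du) (at p) \<and> GDERIV (\<lambda>q. ?\<rho> t q powr \<gamma>) p :> G \<and>
      ?\<rho> t p *\<^sub>R (u\<^sub>t + Du (?u t p)) + K *\<^sub>R G = 0"
    by (rule euler_momentum_equation[OF sol t assms(2-4)])
  assume off: "\<gamma> < 2 \<or> p \<notin> vacuum_boundary ?\<rho> t"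
  show "\<exists>\<rho>\<^sub>t d. ((\<lambda>\<tau>. ?\<rho> \<tau> p) has_real_derivative \<rho>\<^sub>t) (at t within forward_interval T) \<and>
      has_divergence (\<lambda>q. ?\<rho> t q *\<^sub>R ?u t q) d p \<and> \<rho>\<^sub>t + d = 0"
  proof (cases "\<gamma> < 2 \<or> ?w \<noteq> 0")
    case True
    then obtain d where "(profile K \<gamma> \<Lambda> \<alpha> has_real_derivative d) (at (similarity_variable (a t) (b t) p))"
      using profile_differentiable[OF assms(3)] by blast
    then show ?thesis by (rule euler_continuity_equation[OF sol t])
  next
    case False
    \<comment> \<open>Read backwards, \<open>vacuum_boundaryI\<close> leaves only the identically
      vanishing density, for which the equation is trivial.\<close>
    then have "1 < \<gamma>" "?w = 0" "p \<notin> vacuum_boundary ?\<rho> t" using off by auto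
    with vacuum_boundaryI[of K \<gamma> a t b \<alpha> \<Lambda> p] emden_solutionD(6,7)[OF sol t] assms(2,4)
    have "\<not> (0 < \<alpha> \<or> \<Lambda> < 0)" by blast
    then have "\<alpha> = 0" "0 \<le> \<Lambda>" using assms(4) by auto
    then have "?\<rho> \<tau> q = 0" for \<tau> q
      using gas_density_zero[of K \<gamma> \<Lambda> a b \<tau> q] assms(2) False by simp
    moreover have "has_divergence (\<lambda>q. 0) 0 p"
      unfolding has_divergence_def by (intro exI[of _ "\<lambda>h. 0"]) simp
    ultimately show ?thesis by (intro exI[of _ 0]) simp
  qed
qed

theorem corollary5:
  fixes K \<gamma> \<xi> \<Lambda> \<alpha> a0 a1 b0 b1 :: real
    and T :: ereal
    and a a' b b' :: "real \<Rightarrow> real"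
    and \<rho> :: "real \<Rightarrow> real^3 \<Rightarrow> real"
    and u :: "real \<Rightarrow> real^3 \<Rightarrow> real^3"
  assumes "K > 0" and "\<gamma> \<ge> 1" and "\<xi> \<noteq> 0" and "\<alpha> \<ge> 0" and "a0 > 0" and "b0 > 0"
    and "maximal_emden_solution \<gamma> \<xi> \<Lambda> a0 a1 b0 b1 T a a' b b'"
    and "\<rho> = gas_density K \<gamma> \<Lambda> \<alpha> a b"
    and "u = velocity \<xi> a a' b b'"
  shows "euler_solution K \<gamma> T \<rho> u \<and>
    (\<Lambda> > 0 \<longrightarrow> T = \<infinity>) \<and>
    (\<Lambda> = 0 \<longrightarrow> (b1 \<ge> 0 \<longrightarrow> T = \<infinity>) \<and> (b1 < 0 \<longrightarrow> T < \<infinity>)) \<and>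
    (\<Lambda> < 0 \<longrightarrow> (\<gamma> = 1 \<longrightarrow> T < \<infinity>) \<and> (\<gamma> > 1 \<and> b1 \<le> 0 \<longrightarrow> T < \<infinity>))"
proof -
  have sol: "emden_solution \<gamma> \<xi> \<Lambda> a0 a1 b0 b1 T a a' b b'"
    using assms(7) by (simp add: maximal_emden_solution_def)
  have "euler_solution K \<gamma> T \<rho> u"
    unfolding assms(8,9) by (rule emden_imp_euler_solution[OF sol assms(1,2,4)])
  moreover have "T = \<infinity>" if "\<Lambda> > 0 \<or> \<Lambda> = 0 \<and> b1 \<ge> 0"
    by (rule emden_global[OF assms(7,2,3) that])
  moreover have "T < \<infinity>" if "\<Lambda> = 0" "b1 < 0"
    using emden_blowup_free sol that by blast
  moreover have "T < \<infinity>" if "\<Lambda> < 0" "\<gamma> = 1"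
    using emden_blowup_isothermal sol that by blast
  moreover have "T < \<infinity>" if "\<Lambda> < 0" "b1 \<le> 0"
    using emden_blowup_attractive[OF sol that] .
  ultimately show ?thesis by blast
qed

end
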